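(* Let $k>1$ be an integer and let $n\geq k^4+k^3+4k^2+k+6$. Let $G$ be a connected graph with $n$ vertices and minimum degree $\delta(G)\geq k$. If \[ q(G)\geq 2(n-k-1), \] then $G$ has a Hamiltonian cycle, unless $G\in\mathcal{M}_1(n,k)$ or $G\in\mathcal{L}_1(n,k)$.
   Context: All graphs are simple and finite. For a graph $G$, $Q(G)=D+A$ is the signless Laplacian matrix, where $D$ is the diagonal matrix of vertex degrees and $A$ the adjacency matrix, and $q(G)$ denotes the largest eigenvalue of $Q(G)$. $K_m$ is the complete graph on $m$ vertices and $\overline{K}_m$ the edgeless graph on $m$ vertices. $G+H$ is the disjoint union of $G$ and $H$, and $G\vee H$ is their join, i.e. the disjoint union together with all edges between $V(G)$ and $V(H)$. For $E'\subseteq E(G)$, $G-E'$ denotes the graph obtained from $G$ by deleting the edges in $E'$. Membership of a graph in the families below is understood up to isomorphism. For $k>1$ and $n\geq 2k+1$, let $M_k(n)=K_k\vee(K_{n-2k}+\overline{K}_k)$. Let $X$ be the set of vertices of degree $k$ (the vertices of $\overline{K}_k$), $Y$ the set of vertices of degree $n-1$ (the vertices of $K_k$), and $Z$ the set of vertices of degree $n-k-1$ (the vertices of $K_{n-2k}$). Let $E_1(M_k(n))$ be the set of edges of $M_k(n)$ with both endpoints in $Y\cup Z$. Define \[ \mathcal{M}_1(n,k)=\{M_k(n)-E' : E'\subset E_1(M_k(n)),\ |E'|\leq \lfloor k^2/4\rfloor\}. \] For $k\geq1$ and $n\geq k+2$, let $L_k(n)=K_1\vee(K_{n-k-1}+K_k)$.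 Let $X$ be the set of vertices of degree $k$ (the vertices of $K_k$), $Y$ the set of vertices of degree $n-1$ (the single vertex of $K_1$), and $Z$ the set of vertices of degree $n-k-1$ (the vertices of $K_{n-k-1}$). Let $E_1(L_k(n))$ be the set of edges of $L_k(n)$ with both endpoints in $Y\cup Z$. Define \[ \mathcal{L}_1(n,k)=\{L_k(n)-E' : E'\subset E_1(L_k(n)),\ |E'|\leq \lfloor k/4\rfloor\}. \] *)

theory Defs
  imports "Graph_Theory.Graph_Theory" "Jordan_Normal_Form.Spectral_Radius"
begin

text \<open>
  A finite simple graph is a \<^locale>\<open>pair_graph\<close>: a finite symmetric loop-free digraph whose arcs
  are pairs of vertices, so that an edge \<open>uv\<close> is represented by the two arcs \<open>(u,v)\<close> and \<open>(v,u)\<close>.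
  Consequently the degree of a vertex is its \<^const>\<open>out_degree\<close>.
\<close>

definition edges :: "'a pair_pre_digraph \<Rightarrow> 'a set set" where
  "edges G = {{u, v} | u v. (u, v) \<in> parcs G}"

definition min_degree :: "'a pair_pre_digraph \<Rightarrow> nat" where
  "min_degree G = Min (out_degree (with_proj G) ` pverts G)"

text \<open>
  The library's notion of a cycle admits the closed walk \<open>u, v, u\<close> along a single edge of a graph;
  the bound on the length excludes it.
\<close>

definition has_hamiltonian_cycle :: "'a pair_pre_digraph \<Rightarrow> bool" where
  "has_hamiltonian_cycle G \<longleftrightarrow>
     (\<exists>p. pre_digraph.cycle (with_proj G) p \<and> 3 \<le> length p \<and> fst ` set p = pverts G)"


subsection \<open>The signless Laplacian\<close>

text \<open>
  Matrices are indexed by \<open>0, \<dots>, n - 1\<close>, so rows and columns are labelled through a chosen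
  enumeration of the vertices. The spectrum does not depend on the choice, see
  \<open>eigenvalue_signless_laplacian_iff\<close> below.
\<close>

definition vertex_list :: "'a pair_pre_digraph \<Rightarrow> 'a list" where
  "vertex_list G = (SOME vs. distinct vs \<and> set vs = pverts G)"

definition adjacency_matrix :: "'a pair_pre_digraph \<Rightarrow> real mat" where
  "adjacency_matrix G = (let vs = vertex_list G; n = length vs in
     mat n n (\<lambda>(i, j). if (vs ! i, vs ! j) \<in> parcs G then 1 else 0))"

definition degree_matrix :: "'a pair_pre_digraph \<Rightarrow> real mat" where
  "degree_matrix G = (let vs = vertex_list G; n = length vs in
     mat n n (\<lambda>(i, j). if i = j then real (out_degree (with_proj G) (vs ! i)) else 0))"

definition signless_laplacian :: "'a pair_pre_digraph \<Rightarrow> real mat" where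
  "signless_laplacian G = degree_matrix G + adjacency_matrix G"

text \<open>The matrix is real symmetric, so its real spectrum is its whole complex spectrum.\<close>

definition q_index :: "'a pair_pre_digraph \<Rightarrow> real" where
  "q_index G = Max (spectrum (signless_laplacian G))"


subsection \<open>Graph operations\<close>

definition complete_graph :: "nat \<Rightarrow> nat pair_pre_digraph" where
  "complete_graph m = \<lparr>pverts = {..<m}, parcs = {(u, v). u < m \<and> v < m \<and> u \<noteq> v}\<rparr>"

definition edgeless_graph :: "nat \<Rightarrow> nat pair_pre_digraph" where
  "edgeless_graph m = \<lparr>pverts = {..<m}, parcs = {}\<rparr>"

definition disjoint_union ::
    "'a pair_pre_digraph \<Rightarrow> 'b pair_pre_digraph \<Rightarrow> ('a + 'b) pair_pre_digraph" where
  "disjoint_union G H =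
     \<lparr>pverts = pverts G <+> pverts H,
      parcs = {(Inl u, Inl v) | u v. (u, v) \<in> parcs G} \<union> {(Inr u, Inr v) | u v. (u, v) \<in> parcs H}\<rparr>"

definition join ::
    "'a pair_pre_digraph \<Rightarrow> 'b pair_pre_digraph \<Rightarrow> ('a + 'b) pair_pre_digraph" where
  "join G H =
     \<lparr>pverts = pverts G <+> pverts H,
      parcs = parcs (disjoint_union G H)
        \<union> {(Inl u, Inr v) | u v. u \<in> pverts G \<and> v \<in> pverts H}
        \<union> {(Inr v, Inl u) | u v. u \<in> pverts G \<and> v \<in> pverts H}\<rparr>"

definition delete_edges :: "'a pair_pre_digraph \<Rightarrow> 'a set set \<Rightarrow> 'a pair_pre_digraph" where
  "delete_edges G E' =
     \<lparr>pverts = pverts G, parcs = {(u, v). (u, v) \<in> parcs G \<and> {u, v} \<notin> E'}\<rparr>"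

definition mem_up_to_iso :: "'a pair_pre_digraph \<Rightarrow> 'b pair_pre_digraph set \<Rightarrow> bool" where
  "mem_up_to_iso G F \<longleftrightarrow> (\<exists>H\<in>F. digraph_iso (with_proj G) (with_proj H))"


subsection \<open>The exceptional families\<close>

text \<open>Meaningful for \<open>k > 1\<close> and \<open>n \<ge> 2 * k + 1\<close>.\<close>

definition M_graph :: "nat \<Rightarrow> nat \<Rightarrow> (nat + (nat + nat)) pair_pre_digraph" where
  "M_graph k n =
     join (complete_graph k) (disjoint_union (complete_graph (n - 2 * k)) (edgeless_graph k))"

text \<open>
  \<open>Y\<close> and \<open>Z\<close> are taken as the vertex sets of the parts \<open>K\<^sub>k\<close> and \<open>K\<^sub>n\<^sub>-\<^sub>2\<^sub>k\<close>. Describing them by their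
  degrees \<open>n - 1\<close> and \<open>n - k - 1\<close> is the same except for \<open>n = 2 * k + 1\<close>, where the vertex in \<open>Z\<close> also
  has degree \<open>k\<close>; see \<open>M_graph_degrees\<close>.
\<close>

definition M_Y :: "nat \<Rightarrow> nat \<Rightarrow> (nat + (nat + nat)) set" where
  "M_Y k n = Inl ` pverts (complete_graph k)"

definition M_Z :: "nat \<Rightarrow> nat \<Rightarrow> (nat + (nat + nat)) set" where
  "M_Z k n = (Inr \<circ> Inl) ` pverts (complete_graph (n - 2 * k))"

definition M_E1 :: "nat \<Rightarrow> nat \<Rightarrow> (nat + (nat + nat)) set set" where
  "M_E1 k n = {e \<in> edges (M_graph k n). e \<subseteq> M_Y k n \<union> M_Z k n}"

definition M1_family :: "nat \<Rightarrow> nat \<Rightarrow> (nat + (nat + nat)) pair_pre_digraph set" where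
  "M1_family n k = {delete_edges (M_graph k n) E' | E'.
     E' \<subseteq> M_E1 k n \<and> int (card E') \<le> \<lfloor>real k ^ 2 / 4\<rfloor>}"

text \<open>Meaningful for \<open>k \<ge> 1\<close> and \<open>n \<ge> k + 2\<close>.\<close>

definition L_graph :: "nat \<Rightarrow> nat \<Rightarrow> (nat + (nat + nat)) pair_pre_digraph" where
  "L_graph k n =
     join (complete_graph 1) (disjoint_union (complete_graph (n - k - 1)) (complete_graph k))"

definition L_Y :: "nat \<Rightarrow> nat \<Rightarrow> (nat + (nat + nat)) set" where
  "L_Y k n = Inl ` pverts (complete_graph 1)"

definition L_Z :: "nat \<Rightarrow> nat \<Rightarrow> (nat + (nat + nat)) set" where
  "L_Z k n = (Inr \<circ> Inl) ` pverts (complete_graph (n - k - 1))"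

definition L_E1 :: "nat \<Rightarrow> nat \<Rightarrow> (nat + (nat + nat)) set set" where
  "L_E1 k n = {e \<in> edges (L_graph k n). e \<subseteq> L_Y k n \<union> L_Z k n}"

definition L1_family :: "nat \<Rightarrow> nat \<Rightarrow> (nat + (nat + nat)) pair_pre_digraph set" where
  "L1_family n k = {delete_edges (L_graph k n) E' | E'.
     E' \<subseteq> L_E1 k n \<and> int (card E') \<le> \<lfloor>real k / 4\<rfloor>}"


subsection \<open>Consistency of the definitions\<close>

lemma pair_graphI_simple:
  assumes "finite (pverts G)"
    and "\<And>u v. (u, v) \<in> parcs G \<Longrightarrow> u \<in> pverts G \<and> v \<in> pverts G \<and> u \<noteq> v \<and> (v, u) \<in> parcs G"
  shows "pair_graph G"
proof -
  have "parcs G \<subseteq> pverts G \<times> pverts G" using assms(2) by auto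
  then have "finite (parcs G)" using assms(1) by (meson finite_SigmaI finite_subset)
  moreover have "symmetric (with_proj G)"
    using assms(2) by (auto simp: symmetric_def intro!: symI)
  ultimately show ?thesis
    using assms by unfold_locales (fastforce dest: assms(2))+
qed

lemma pair_graph_arcD:
  assumes "pair_graph G" "(u, v) \<in> parcs G"
  shows "u \<in> pverts G" "v \<in> pverts G" "u \<noteq> v" "(v, u) \<in> parcs G"
proof -
  interpret pair_graph G by (rule assms(1))
  show "u \<in> pverts G" "v \<in> pverts G" "u \<noteq> v" "(v, u) \<in> parcs G"
    using assms(2) in_arcsD1 in_arcsD2 no_loops' arcs_symmetric by auto
qed

lemma finite_pverts: "pair_graph G \<Longrightarrow> finite (pverts G)"
  by (simp add: pair_graph_def pair_digraph_def pair_fin_digraph_def pair_fin_digraph_axioms_def)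

lemma pair_graph_complete_graph: "pair_graph (complete_graph m)"
  by (rule pair_graphI_simple) (auto simp: complete_graph_def)

lemma complete_digraph_complete_graph: "complete_digraph m (with_proj (complete_graph m))"
  unfolding complete_digraph_def
  using pair_graph.pair_graphD_graph[OF pair_graph_complete_graph]
  by (auto simp: complete_graph_def)

lemma pair_graph_edgeless_graph: "pair_graph (edgeless_graph m)"
  by (rule pair_graphI_simple) (auto simp: edgeless_graph_def)

lemma pair_graph_disjoint_union:
  "pair_graph G \<Longrightarrow> pair_graph H \<Longrightarrow> pair_graph (disjoint_union G H)"
  by (rule pair_graphI_simple)
     (auto simp: disjoint_union_def finite_pverts dest: pair_graph_arcD)

lemma pair_graph_join:
  "pair_graph G \<Longrightarrow> pair_graph H \<Longrightarrow> pair_graph (join G H)"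
  by (rule pair_graphI_simple)
     (auto simp: join_def disjoint_union_def finite_pverts dest: pair_graph_arcD)

lemma pair_graph_delete_edges: "pair_graph G \<Longrightarrow> pair_graph (delete_edges G E')"
  by (rule pair_graphI_simple)
     (auto simp: delete_edges_def finite_pverts insert_commute dest: pair_graph_arcD)

lemma pair_graph_M1_family: "H \<in> M1_family n k \<Longrightarrow> pair_graph H"
  by (auto simp: M1_family_def M_graph_def intro!: pair_graph_delete_edges pair_graph_join
        pair_graph_disjoint_union pair_graph_complete_graph pair_graph_edgeless_graph)

lemma pair_graph_L1_family: "H \<in> L1_family n k \<Longrightarrow> pair_graph H"
  by (auto simp: L1_family_def L_graph_def intro!: pair_graph_delete_edges pair_graph_join
        pair_graph_disjoint_union pair_graph_complete_graph)

lemma out_degree_with_proj: "out_degree (with_proj G) v = card {u. (v, u) \<in> parcs G}"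
proof -
  have "out_arcs (with_proj G) v = Pair v ` {u. (v, u) \<in> parcs G}"
    by (auto simp: out_arcs_def)
  then show ?thesis by (simp add: out_degree_def card_image inj_on_def)
qed

lemma M_graph_degrees:
  assumes "2 * k + 1 \<le> n"
  shows "y \<in> M_Y k n \<Longrightarrow> out_degree (with_proj (M_graph k n)) y = n - 1"
    and "z \<in> M_Z k n \<Longrightarrow> out_degree (with_proj (M_graph k n)) z = n - k - 1"
    and "x \<in> pverts (M_graph k n) - (M_Y k n \<union> M_Z k n)
      \<Longrightarrow> out_degree (with_proj (M_graph k n)) x = k"
proof -
  have Y: "{u. (Inl i, u) \<in> parcs (M_graph k n)}
      = ({..<k} - {i}) <+> ({..<n - 2 * k} <+> {..<k})" if "i < k" for i
    using that by (auto simp: M_graph_def join_def disjoint_union_def complete_graph_def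
        edgeless_graph_def)
  have Z: "{u. (Inr (Inl i), u) \<in> parcs (M_graph k n)}
      = {..<k} <+> (({..<n - 2 * k} - {i}) <+> {})" if "i < n - 2 * k" for i
    using that by (auto simp: M_graph_def join_def disjoint_union_def complete_graph_def
        edgeless_graph_def)
  have X: "{u. (Inr (Inr i), u) \<in> parcs (M_graph k n)} = {..<k} <+> {}" if "i < k" for i
    using that by (auto simp: M_graph_def join_def disjoint_union_def complete_graph_def
        edgeless_graph_def)
  show "y \<in> M_Y k n \<Longrightarrow> out_degree (with_proj (M_graph k n)) y = n - 1"
    using assms
    by (auto simp: M_Y_def complete_graph_def out_degree_with_proj Y card_Plus card_Diff_singleton)
  show "z \<in> M_Z k n \<Longrightarrow> out_degree (with_proj (M_graph k n)) z = n - k - 1"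
    using assms
    by (auto simp: M_Z_def complete_graph_def out_degree_with_proj Z card_Plus card_Diff_singleton)
  show "x \<in> pverts (M_graph k n) - (M_Y k n \<union> M_Z k n)
      \<Longrightarrow> out_degree (with_proj (M_graph k n)) x = k"
    using X by (auto simp: M_Y_def M_Z_def M_graph_def join_def disjoint_union_def
        complete_graph_def edgeless_graph_def out_degree_with_proj card_Plus)
qed

lemma L_graph_degrees:
  assumes "k + 2 \<le> n"
  shows "y \<in> L_Y k n \<Longrightarrow> out_degree (with_proj (L_graph k n)) y = n - 1"
    and "z \<in> L_Z k n \<Longrightarrow> out_degree (with_proj (L_graph k n)) z = n - k - 1"
    and "x \<in> pverts (L_graph k n) - (L_Y k n \<union> L_Z k n)
      \<Longrightarrow> out_degree (with_proj (L_graph k n)) x = k"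
proof -
  have Y: "{u. (Inl 0, u) \<in> parcs (L_graph k n)} = {} <+> ({..<n - k - 1} <+> {..<k})"
    by (auto simp: L_graph_def join_def disjoint_union_def complete_graph_def)
  have Z: "{u. (Inr (Inl i), u) \<in> parcs (L_graph k n)}
      = {0} <+> (({..<n - k - 1} - {i}) <+> {})" if "i < n - k - 1" for i
    using that by (auto simp: L_graph_def join_def disjoint_union_def complete_graph_def)
  have X: "{u. (Inr (Inr i), u) \<in> parcs (L_graph k n)}
      = {0} <+> ({} <+> ({..<k} - {i}))" if "i < k" for i
    using that by (auto simp: L_graph_def join_def disjoint_union_def complete_graph_def)
  show "y \<in> L_Y k n \<Longrightarrow> out_degree (with_proj (L_graph k n)) y = n - 1"
    using assms
    by (auto simp: L_Y_def complete_graph_def out_degree_with_proj Y card_Plus)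
  show "z \<in> L_Z k n \<Longrightarrow> out_degree (with_proj (L_graph k n)) z = n - k - 1"
    using assms
    by (auto simp: L_Z_def complete_graph_def out_degree_with_proj Z card_Plus card_Diff_singleton)
  show "x \<in> pverts (L_graph k n) - (L_Y k n \<union> L_Z k n)
      \<Longrightarrow> out_degree (with_proj (L_graph k n)) x = k"
    using X by (auto simp: L_Y_def L_Z_def L_graph_def join_def disjoint_union_def
        complete_graph_def out_degree_with_proj card_Plus card_Diff_singleton)
qed

lemma digraph_iso_with_proj_iff:
  assumes "pair_graph G"
  shows "digraph_iso (with_proj G) (with_proj H) \<longleftrightarrow>
    (\<exists>f. bij_betw f (pverts G) (pverts H) \<and> parcs H = map_prod f f ` parcs G)"
proof
  assume "digraph_iso (with_proj G) (with_proj H)"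
  then obtain g where g: "pre_digraph.digraph_isomorphism (with_proj G) g"
    and H: "with_proj H = app_iso g (with_proj G)"
    by (auto simp: digraph_iso_def)
  have V: "pverts H = iso_verts g ` pverts G" and A: "parcs H = iso_arcs g ` parcs G"
    and T: "iso_tail g = fst" and S: "iso_head g = snd"
    using arg_cong[OF H, of verts] arg_cong[OF H, of arcs] arg_cong[OF H, of tail]
      arg_cong[OF H, of head] by simp_all
  have "iso_arcs g a = map_prod (iso_verts g) (iso_verts g) a" if "a \<in> parcs G" for a
    using g that by (auto simp: pre_digraph.digraph_isomorphism_def T S prod_eq_iff)
  then have "parcs H = map_prod (iso_verts g) (iso_verts g) ` parcs G"
    unfolding A by (rule image_cong[OF refl])
  moreover have "bij_betw (iso_verts g) (pverts G) (pverts H)"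
    using g by (simp add: bij_betw_def V pre_digraph.digraph_isomorphism_def)
  ultimately show "\<exists>f. bij_betw f (pverts G) (pverts H) \<and> parcs H = map_prod f f ` parcs G"
    by blast
next
  assume "\<exists>f. bij_betw f (pverts G) (pverts H) \<and> parcs H = map_prod f f ` parcs G"
  then obtain f where f: "bij_betw f (pverts G) (pverts H)" "parcs H = map_prod f f ` parcs G"
    by blast
  interpret pair_graph G by (rule assms)
  define g where "g = \<lparr>iso_verts = f, iso_arcs = map_prod f f, iso_head = snd, iso_tail = fst\<rparr>"
  have "inj_on (map_prod f f) (pverts G \<times> pverts G)"
    using f(1) by (auto simp: bij_betw_def intro: map_prod_inj_on)
  moreover have "parcs G \<subseteq> pverts G \<times> pverts G" using in_arcsD1 in_arcsD2 by auto
  ultimately have "inj_on (map_prod f f) (parcs G)" by (rule inj_on_subset)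
  then have "pre_digraph.digraph_isomorphism (with_proj G) g"
    using f wf_digraph by (auto simp: pre_digraph.digraph_isomorphism_def g_def bij_betw_def)
  moreover have "with_proj H = app_iso g (with_proj G)"
    using f by (simp add: with_proj_def app_iso_def g_def bij_betw_def)
  ultimately show "digraph_iso (with_proj G) (with_proj H)"
    by (auto simp: digraph_iso_def)
qed

lemma vertex_list:
  assumes "finite (pverts G)"
  shows "distinct (vertex_list G)" "set (vertex_list G) = pverts G"
  using someI_ex[OF finite_distinct_list[OF assms, simplified conj_commute]]
  by (auto simp: vertex_list_def)

lemma eigenvalue_signless_laplacian_iff:
  assumes G: "pair_graph G"
  shows "eigenvalue (signless_laplacian G) c \<longleftrightarrow>
    (\<exists>x. (\<exists>v\<in>pverts G. x v \<noteq> 0) \<and>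
       (\<forall>v\<in>pverts G. real (out_degree (with_proj G) v) * x v + (\<Sum>u | (v, u) \<in> parcs G. x u)
          = c * x v))"
proof -
  define vs where "vs = vertex_list G"
  define n where "n = length vs"
  have d: "distinct vs" and s: "set vs = pverts G"
    using vertex_list[OF finite_pverts[OF G]] by (simp_all add: vs_def)
  have bij: "bij_betw ((!) vs) {0..<n} (pverts G)"
    using bij_betw_nth[OF d] s by (simp add: n_def atLeast0LessThan)
  have all: "(\<forall>v\<in>pverts G. P v) \<longleftrightarrow> (\<forall>i<n. P (vs ! i))" for P
    unfolding s[symmetric] n_def by (simp add: all_set_conv_all_nth)
  have dim: "dim_row (signless_laplacian G) = n"
    by (simp add: signless_laplacian_def adjacency_matrix_def degree_matrix_def Let_def n_def vs_def)
  have row: "(signless_laplacian G *\<^sub>v w) $ i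
      = real (out_degree (with_proj G) (vs ! i)) * x (vs ! i)
        + (\<Sum>u | (vs ! i, u) \<in> parcs G. x u)"
    if i: "i < n" and w: "w \<in> carrier_vec n" and x: "\<And>j. j < n \<Longrightarrow> w $ j = x (vs ! j)" for w x i
  proof -
    have sub: "{u. (vs ! i, u) \<in> parcs G} \<subseteq> pverts G"
      using pair_graph_arcD[OF G] by auto
    have "(signless_laplacian G *\<^sub>v w) $ i
        = (\<Sum>j = 0..<n. ((if i = j then real (out_degree (with_proj G) (vs ! i)) else 0)
            + (if (vs ! i, vs ! j) \<in> parcs G then 1 else 0)) * x (vs ! j))"
      using i w x by (auto simp: signless_laplacian_def adjacency_matrix_def degree_matrix_def
          Let_def scalar_prod_def n_def[symmetric] vs_def[symmetric] intro!: sum.cong)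
    also have "\<dots> = (\<Sum>j = 0..<n. if i = j then real (out_degree (with_proj G) (vs ! i)) * x (vs ! j) else 0)
        + (\<Sum>j = 0..<n. if (vs ! i, vs ! j) \<in> parcs G then x (vs ! j) else 0)"
      unfolding sum.distrib[symmetric] by (rule sum.cong) (simp_all add: distrib_right)
    also have "(\<Sum>j = 0..<n. if (vs ! i, vs ! j) \<in> parcs G then x (vs ! j) else 0)
        = (\<Sum>u\<in>pverts G. if (vs ! i, u) \<in> parcs G then x u else 0)"
      using sum.reindex_bij_betw[OF bij, of "\<lambda>u. if (vs ! i, u) \<in> parcs G then x u else 0"] .
    also have "\<dots> = (\<Sum>u | (vs ! i, u) \<in> parcs G. x u)"
      using sub finite_pverts[OF G] by (subst sum.inter_filter[symmetric]) (auto intro!: sum.cong)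
    finally show ?thesis using i by simp
  qed
  show ?thesis
  proof
    assume "eigenvalue (signless_laplacian G) c"
    then obtain w where w: "w \<in> carrier_vec n" "w \<noteq> 0\<^sub>v n"
      and ev: "signless_laplacian G *\<^sub>v w = c \<cdot>\<^sub>v w"
      by (auto simp: eigenvalue_def eigenvector_def dim)
    define x where "x v = w $ the_inv_into {0..<n} ((!) vs) v" for v
    have x: "w $ j = x (vs ! j)" if "j < n" for j
      using that bij by (simp add: x_def bij_betw_def the_inv_into_f_f)
    obtain i where i: "i < n" "w $ i \<noteq> 0" using w by (auto simp: vec_eq_iff)
    have "\<exists>v\<in>pverts G. x v \<noteq> 0" using i x s by (metis n_def nth_mem)
    moreover have "real (out_degree (with_proj G) (vs ! i)) * x (vs ! i)
        + (\<Sum>u | (vs ! i, u) \<in> parcs G. x u) = c * x (vs ! i)" if "i < n" for i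
      using row[OF that w(1) x, symmetric] w(1) x[OF that] that by (simp add: ev)
    ultimately show "\<exists>x. (\<exists>v\<in>pverts G. x v \<noteq> 0) \<and>
       (\<forall>v\<in>pverts G. real (out_degree (with_proj G) v) * x v + (\<Sum>u | (v, u) \<in> parcs G. x u)
          = c * x v)"
      by (intro exI[of _ x]) (simp add: all)
  next
    assume "\<exists>x. (\<exists>v\<in>pverts G. x v \<noteq> 0) \<and>
       (\<forall>v\<in>pverts G. real (out_degree (with_proj G) v) * x v + (\<Sum>u | (v, u) \<in> parcs G. x u)
          = c * x v)"
    then obtain x v where v: "v \<in> pverts G" "x v \<noteq> 0"
      and eq: "\<forall>v\<in>pverts G. real (out_degree (with_proj G) v) * x v
        + (\<Sum>u | (v, u) \<in> parcs G. x u) = c * x v" by blast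
    define w where "w = vec n (\<lambda>i. x (vs ! i))"
    have w: "w \<in> carrier_vec n" and x: "\<And>j. j < n \<Longrightarrow> w $ j = x (vs ! j)"
      by (simp_all add: w_def)
    obtain i where "i < n" "vs ! i = v" using v(1) s by (metis in_set_conv_nth n_def)
    then have "w \<noteq> 0\<^sub>v n" using v(2) x by auto
    moreover have "signless_laplacian G *\<^sub>v w = c \<cdot>\<^sub>v w"
    proof (rule eq_vecI)
      fix i assume "i < dim_vec (c \<cdot>\<^sub>v w)"
      then have i: "i < n" by (simp add: w_def)
      show "(signless_laplacian G *\<^sub>v w) $ i = (c \<cdot>\<^sub>v w) $ i"
        using row[OF i w x] eq[unfolded all] i w x[OF i] by simp
    qed (simp add: dim w_def)
    ultimately show "eigenvalue (signless_laplacian G) c"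
      using w by (auto simp: eigenvalue_def eigenvector_def dim)
  qed
qed

end

theory Submission
  imports Defs
begin

text \<open>
  The eigenvalue equation forces at most \<open>k (n - 1)\<close> non-edges. Saturating a non-Hamiltonian \<open>G\<close>, the
  Ore condition then yields a clique on \<open>n - k\<close> vertices whose complement \<open>X\<close> consists of vertices of
  degree exactly \<open>k\<close>, all with the same neighbourhood \<open>Y\<close> in the clique; only \<open>\<bar>Y\<bar> \<in> {1, k}\<close> is
  compatible with being non-Hamiltonian. Finally, an eigenvector \<open>x\<close> for \<open>q \<ge> 2 (n - k - 1)\<close> is almost
  constant on \<open>C = V - X\<close>, say \<open>1\<close>, and almost zero on \<open>X\<close>. In the Rayleigh quotient each
  edge between \<open>X\<close> and \<open>Y\<close> then gains about \<open>1\<close> over the clique on \<open>C\<close> and each edge missing inside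
  \<open>C\<close> loses about \<open>4\<close>, so at most \<open>k \<bar>Y\<bar> / 4\<close> edges are missing.
\<close>

subsection \<open>Hamiltonian cycles and Ore's theorem\<close>

text \<open>The obstacle is sharpness: the bound on the missing edges is the exact integer part of
  \<open>k * card Y / 4\<close>, so the comparison must be settled within less than one edge. Let
  \<open>m\<close> be this integer part plus one. Then \<open>4 * m\<close> exceeds
  \<open>k * card Y\<close> by at least 3 if \<open>card Y = k\<close> and by at least 1 if
  \<open>card Y = 1\<close>. All errors, which come from the deviation of the eigenvector from a
  constant on \<open>C\<close> and from its values on \<open>X\<close>, have to fit into this gap.
  So the weight \<open>l\<close> of the mixed terms over missing pairs must keep
  \<open>l * m\<close> bounded, and the resulting term \<open>8 * m / l\<close>, of order
  \<open>m^2\<close>, must stay below \<open>card C\<close>: for \<open>card Y = k\<close> this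
  makes \<open>n\<close> of order \<open>k^4\<close>. Saturation serves to locate \<open>X\<close>
  and \<open>Y\<close>. No added edge meets \<open>X\<close>, because the degrees there are
  \<open>k\<close> in the saturated graph and at least \<open>k\<close> in \<open>G\<close>. Hence
  all edges to be deleted from the exceptional graph lie inside \<open>C\<close>, and they can be
  counted in \<open>G\<close> itself.\<close>

definition sgraph :: "'a set \<Rightarrow> ('a \<times> 'a) set \<Rightarrow> bool" where
  "sgraph V E \<longleftrightarrow> finite V \<and> E \<subseteq> V \<times> V \<and> sym E \<and> irrefl E"

abbreviation deg :: "('a \<times> 'a) set \<Rightarrow> 'a \<Rightarrow> nat" where
  "deg E v \<equiv> card (E `` {v})"

definition hamiltonian :: "'a set \<Rightarrow> ('a \<times> 'a) set \<Rightarrow> bool" where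
  "hamiltonian V E \<longleftrightarrow> (\<exists>xs. distinct xs \<and> set xs = V \<and> 3 \<le> length xs
     \<and> successively (\<lambda>u v. (u, v) \<in> E) xs \<and> (last xs, hd xs) \<in> E)"

lemma sgraphD:
  assumes "sgraph V E"
  shows "finite V" "finite E" "\<And>v. finite (E `` {v})"
    and "(u, v) \<in> E \<Longrightarrow> u \<in> V" "(u, v) \<in> E \<Longrightarrow> v \<in> V"
    and "(u, v) \<in> E \<Longrightarrow> (v, u) \<in> E" "(u, v) \<in> E \<Longrightarrow> u \<noteq> v"
proof -
  show "finite V" "finite E"
    using assms finite_subset[of E "V \<times> V"] by (auto simp: sgraph_def)
  then show "finite (E `` {v})" for v by (simp add: finite_Image)
qed (use assms in \<open>auto simp: sgraph_def irrefl_def dest: symD\<close>)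

lemma deg_less_card:
  assumes "sgraph V E" "v \<in> V"
  shows "deg E v < card V"
proof -
  have "E `` {v} \<subset> V" using sgraphD(5,7)[OF assms(1)] assms(2) by auto
  then show ?thesis using sgraphD(1)[OF assms(1)] by (rule psubset_card_mono[rotated])
qed

text \<open>\<open>E\<close> contains both orientations of each edge, so \<open>card E\<close> is
  twice the number of edges. All later bounds on \<open>card E\<close> and all sums over
  \<open>E\<close> carry this factor 2.\<close>

lemma card_eq_sum_deg:
  assumes "sgraph V E"
  shows "card E = (\<Sum>v\<in>V. deg E v)"
proof -
  have "E = Sigma V (\<lambda>v. E `` {v})" using sgraphD(4)[OF assms] by auto
  then have "card E = card (Sigma V (\<lambda>v. E `` {v}))" by simp
  also have "\<dots> = (\<Sum>v\<in>V. deg E v)"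
    using sgraphD(1,3)[OF assms] by (subst card_SigmaI) auto
  finally show ?thesis .
qed

lemma successively_iff_nth:
  "successively P xs \<longleftrightarrow> (\<forall>i. Suc i < length xs \<longrightarrow> P (xs ! i) (xs ! Suc i))"
proof (induction P xs rule: successively.induct)
  case (3 P x y xs)
  have all_nat: "(\<forall>i. Q i) \<longleftrightarrow> Q 0 \<and> (\<forall>i. Q (Suc i))" for Q :: "nat \<Rightarrow> bool"
    by (metis not0_implies_Suc)
  show ?case by (subst all_nat) (simp add: 3)
qed auto

text \<open>Rotating a Hamiltonian cycle so that an edge used by it becomes the closing edge.\<close>

lemma hamiltonian_insert_edge_path:
  assumes "hamiltonian V (E \<union> {(a, b), (b, a)})" and "\<not> hamiltonian V E"
  shows "\<exists>ys. distinct ys \<and> set ys = V \<and> 3 \<le> length ys \<and> {hd ys, last ys} = {a, b}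
     \<and> successively (\<lambda>u v. (u, v) \<in> E) ys"
proof -
  let ?E = "E \<union> {(a, b), (b, a)}"
  obtain xs where xs: "distinct xs" "set xs = V" "3 \<le> length xs"
    and suc: "successively (\<lambda>u v. (u, v) \<in> ?E) xs" and cl: "(last xs, hd xs) \<in> ?E"
    using assms(1) by (auto simp: hamiltonian_def)
  obtain ys where ys: "distinct ys" "set ys = V" "3 \<le> length ys" "{hd ys, last ys} = {a, b}"
    and sy: "successively (\<lambda>u v. (u, v) \<in> ?E) ys"
  proof (cases "successively (\<lambda>u v. (u, v) \<in> E) xs")
    case True
    \<comment> \<open>If no inner step needs the new edge, the closing step must use it, since
      otherwise \<open>E\<close> itself would be Hamiltonian.\<close>
    then have "(last xs, hd xs) \<in> {(a, b), (b, a)}"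
      using assms(2) cl xs by (auto simp: hamiltonian_def)
    then show ?thesis using that[of xs] xs suc by auto
  next
    case False
    then obtain i where i: "Suc i < length xs" "(xs ! i, xs ! Suc i) \<in> {(a, b), (b, a)}"
      using suc by (auto simp: successively_iff_nth)
    define ys where "ys = drop (Suc i) xs @ take (Suc i) xs"
    have ne: "drop (Suc i) xs \<noteq> []" "take (Suc i) xs \<noteq> []" using i by auto
    have "hd ys = xs ! Suc i" "last ys = xs ! i"
      using i ne by (auto simp: ys_def hd_drop_conv_nth take_Suc_conv_app_nth)
    moreover have "set ys = V"
      using xs(2) set_append[of "take (Suc i) xs" "drop (Suc i) xs"] by (auto simp: ys_def)
    moreover have "distinct ys"
      using xs(1) set_take_disj_set_drop_if_distinct[OF xs(1), of "Suc i" "Suc i"]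
      by (auto simp: ys_def)
    moreover have "successively (\<lambda>u v. (u, v) \<in> ?E) ys"
    proof -
      have "successively (\<lambda>u v. (u, v) \<in> ?E) (take (Suc i) xs @ drop (Suc i) xs)"
        using suc by simp
      moreover have "last (drop (Suc i) xs) = last xs" "hd (take (Suc i) xs) = hd xs"
        using i by auto
      ultimately show ?thesis
        using cl unfolding ys_def successively_append_iff by auto
    qed
    moreover have "3 \<le> length ys" using xs(3) by (simp add: ys_def)
    ultimately show ?thesis using that[of ys] i by force
  qed
  \<comment> \<open>The new edge joins the two ends of \<open>ys\<close>. An inner step using it
    would make the positions \<open>i\<close> and \<open>Suc i\<close> the first and the last one,
    which is impossible with at least three vertices.\<close>
  have "(ys ! i, ys ! Suc i) \<in> E" if i: "Suc i < length ys" for i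
  proof (rule ccontr)
    assume "(ys ! i, ys ! Suc i) \<notin> E"
    then have "{ys ! i, ys ! Suc i} = {ys ! 0, ys ! (length ys - 1)}"
      using sy i ys(4) hd_conv_nth[of ys] last_conv_nth[of ys]
      by (cases "ys = []") (force simp: successively_iff_nth)+
    then have "{i, Suc i} = {0, length ys - 1}"
      using ys(1) i nth_eq_iff_index_eq[OF ys(1) Suc_lessD[OF i], of 0]
      by (cases "ys = []") (auto simp: doubleton_eq_iff nth_eq_iff_index_eq)
    then show False using ys(3) by (auto simp: doubleton_eq_iff)
  qed
  then show ?thesis using ys by (auto simp: successively_iff_nth)
qed

text \<open>The classical exchange: run along the path up to position \<open>i\<close>, jump to its
  last vertex, return backwards to position \<open>Suc i\<close> and close up with the first
  vertex.\<close>

lemma hamiltonian_if_crossing: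
  assumes "distinct ys" "set ys = V" "3 \<le> length ys" "successively (\<lambda>u v. (u, v) \<in> E) ys"
    and "sym E" and i: "Suc i < length ys" "(hd ys, ys ! Suc i) \<in> E" "(ys ! i, last ys) \<in> E"
  shows "hamiltonian V E"
proof -
  define xs where "xs = take (Suc i) ys @ rev (drop (Suc i) ys)"
  have ne: "drop (Suc i) ys \<noteq> []" "take (Suc i) ys \<noteq> []" using i by auto
  have split: "take (Suc i) ys @ drop (Suc i) ys = ys" by simp
  have e: "hd (drop (Suc i) ys) = ys ! Suc i" "last (take (Suc i) ys) = ys ! i"
     "last (drop (Suc i) ys) = last ys" "hd (take (Suc i) ys) = hd ys"
  proof -
    show "last (take (Suc i) ys) = ys ! i" using i by (simp add: take_Suc_conv_app_nth)
  qed (use i in \<open>auto simp: hd_drop_conv_nth\<close>)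
  have "hd xs = hd ys" "last xs = ys ! Suc i"
    using i ne e by (auto simp: xs_def last_rev)
  moreover have "set xs = V"
    using assms(2) set_append[of "take (Suc i) ys" "drop (Suc i) ys"] by (auto simp: xs_def)
  moreover have "distinct xs"
    using assms(1) set_take_disj_set_drop_if_distinct[OF assms(1), of "Suc i" "Suc i"]
    by (auto simp: xs_def)
  moreover have "successively (\<lambda>u v. (u, v) \<in> E) xs"
  proof -
    have "successively (\<lambda>u v. (u, v) \<in> E) (take (Suc i) ys)"
      "successively (\<lambda>u v. (u, v) \<in> E) (drop (Suc i) ys)"
      using assms(4) split successively_append_iff by metis+
    moreover have "successively (\<lambda>u v. (v, u) \<in> E) (drop (Suc i) ys)"
      using calculation(2) by (rule successively_mono) (use \<open>sym E\<close> in \<open>auto dest: symD\<close>)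
    ultimately show ?thesis
      using i(3) e ne by (auto simp: xs_def successively_append_iff hd_rev)
  qed
  ultimately show ?thesis
    using assms(3,5) i(2) unfolding hamiltonian_def
    by (intro exI[of _ xs]) (auto simp: xs_def dest: symD)
qed

definition edge_maximal_nonhamiltonian :: "'a set \<Rightarrow> ('a \<times> 'a) set \<Rightarrow> bool" where
  "edge_maximal_nonhamiltonian V E \<longleftrightarrow> sgraph V E \<and> \<not> hamiltonian V E
     \<and> (\<forall>u\<in>V. \<forall>v\<in>V. u \<noteq> v \<longrightarrow> (u, v) \<notin> E \<longrightarrow> hamiltonian V (E \<union> {(u, v), (v, u)}))"

text \<open>Adding the edge \<open>uv\<close> creates a Hamiltonian cycle, hence \<open>E\<close>
  has a Hamiltonian path between \<open>u\<close> and \<open>v\<close>. Its \<open>n - 1\<close>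
  steps cannot accommodate the neighbours of both ends without a crossing.\<close>

lemma edge_maximal_nonhamiltonian_degree_sum:
  assumes M: "edge_maximal_nonhamiltonian V E"
    and uv: "u \<in> V" "v \<in> V" "u \<noteq> v" "(u, v) \<notin> E"
  shows "deg E u + deg E v < card V"
proof -
  have G: "sgraph V E" and nh: "\<not> hamiltonian V E"
    using M by (auto simp: edge_maximal_nonhamiltonian_def)
  have "hamiltonian V (E \<union> {(u, v), (v, u)})"
    using M uv by (auto simp: edge_maximal_nonhamiltonian_def)
  then obtain ys where ys: "distinct ys" "set ys = V" "3 \<le> length ys"
      "{hd ys, last ys} = {u, v}" "successively (\<lambda>u v. (u, v) \<in> E) ys"
    using hamiltonian_insert_edge_path nh by metis
  define n where "n = length ys"
  have n: "card V = n" using ys by (auto simp: n_def distinct_card[symmetric])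
  \<comment> \<open>\<open>A\<close> holds the positions just before a neighbour of the first
    vertex, \<open>B\<close> the positions of neighbours of the last one. A common element would be
    a crossing.\<close>
  define A where "A = {i. Suc i < n \<and> (hd ys, ys ! Suc i) \<in> E}"
  define B where "B = {i. Suc i < n \<and> (ys ! i, last ys) \<in> E}"
  have fin: "finite A" "finite B"
    by (rule finite_subset[of _ "{..<n}"]; auto simp: A_def B_def)+
  have "E `` {hd ys} \<subseteq> (\<lambda>i. ys ! Suc i) ` A"
  proof
    fix w assume "w \<in> E `` {hd ys}"
    then have w: "(hd ys, w) \<in> E" by simp
    then obtain j where j: "j < n" "w = ys ! j"
      using sgraphD(5)[OF G] ys(2) by (metis in_set_conv_nth n_def)
    moreover have "j \<noteq> 0"
      using w j ys(3) sgraphD(7)[OF G w] hd_conv_nth[of ys] by (cases "ys = []"; cases j) auto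
    ultimately show "w \<in> (\<lambda>i. ys ! Suc i) ` A"
      using w by (auto simp: A_def intro!: rev_image_eqI[of "j - 1"])
  qed
  then have cA: "deg E (hd ys) \<le> card A" by (rule surj_card_le[OF fin(1)])
  have "E `` {last ys} \<subseteq> (\<lambda>i. ys ! i) ` B"
  proof
    fix w assume "w \<in> E `` {last ys}"
    then have w: "(last ys, w) \<in> E" by simp
    then obtain j where j: "j < n" "w = ys ! j"
      using sgraphD(5)[OF G] ys(2) by (metis in_set_conv_nth n_def)
    moreover have "j \<noteq> n - 1"
      using w j ys(3) sgraphD(7)[OF G w] last_conv_nth[of ys] by (cases "ys = []") (auto simp: n_def)
    ultimately show "w \<in> (\<lambda>i. ys ! i) ` B"
      using w sgraphD(6)[OF G w] by (auto simp: B_def)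
  qed
  then have cB: "deg E (last ys) \<le> card B" by (rule surj_card_le[OF fin(2)])
  have "A \<inter> B = {}"
    using hamiltonian_if_crossing[OF ys(1-3,5)] G nh by (auto simp: A_def B_def n_def sgraph_def)
  then have "card A + card B = card (A \<union> B)" using fin by (simp add: card_Un_disjoint)
  also have "\<dots> \<le> card {..<n - 1}"
    by (rule card_mono) (auto simp: A_def B_def)
  finally have "deg E (hd ys) + deg E (last ys) < n"
    using cA cB ys(3) by (simp add: n_def)
  moreover have "deg E u + deg E v = deg E (hd ys) + deg E (last ys)"
    using ys(4) by (auto simp: doubleton_eq_iff)
  ultimately show ?thesis using n by simp
qed

lemma sgraph_insert_edge:
  "sgraph V E \<Longrightarrow> u \<in> V \<Longrightarrow> v \<in> V \<Longrightarrow> u \<noteq> v \<Longrightarrow> sgraph V (E \<union> {(u, v), (v, u)})"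
  by (auto simp: sgraph_def irrefl_def sym_def)

lemma edge_maximal_nonhamiltonian_extension:
  assumes "sgraph V E" "\<not> hamiltonian V E"
  shows "\<exists>E'. E \<subseteq> E' \<and> edge_maximal_nonhamiltonian V E'"
proof -
  define \<F> where "\<F> = {F. E \<subseteq> F \<and> sgraph V F \<and> \<not> hamiltonian V F}"
  have "\<F> \<subseteq> Pow (V \<times> V)" by (auto simp: \<F>_def sgraph_def)
  then have "finite \<F>"
    using sgraphD(1)[OF assms(1)] by (meson finite_Pow_iff finite_SigmaI finite_subset)
  moreover have "\<F> \<noteq> {}" using assms by (auto simp: \<F>_def)
  ultimately obtain F where F: "F \<in> \<F>" "\<And>F'. F' \<in> \<F> \<Longrightarrow> F \<subseteq> F' \<Longrightarrow> F = F'"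
    using finite_has_maximal[of \<F>] by auto
  have "hamiltonian V (F \<union> {(u, v), (v, u)})" if "u \<in> V" "v \<in> V" "u \<noteq> v" "(u, v) \<notin> F" for u v
  proof (rule ccontr)
    assume "\<not> ?thesis"
    moreover have "sgraph V F" "E \<subseteq> F" using F(1) by (auto simp: \<F>_def)
    ultimately have "F \<union> {(u, v), (v, u)} \<in> \<F>"
      using sgraph_insert_edge[OF _ that(1-3)] by (auto simp: \<F>_def)
    then show False using F(2) that(4) by blast
  qed
  then show ?thesis using F(1) by (auto simp: \<F>_def edge_maximal_nonhamiltonian_def)
qed

lemma hamiltonian_complete:
  assumes "finite V" "3 \<le> card V" "\<And>u v. u \<in> V \<Longrightarrow> v \<in> V \<Longrightarrow> u \<noteq> v \<Longrightarrow> (u, v) \<in> E"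
  shows "hamiltonian V E"
proof -
  obtain xs where xs: "set xs = V" "distinct xs" using finite_distinct_list[OF assms(1)] by auto
  then have l: "3 \<le> length xs" using assms(2) distinct_card by metis
  have "(last xs, hd xs) \<in> E"
  proof (rule assms(3))
    show "last xs \<in> V" "hd xs \<in> V" using xs(1) l by (cases xs; force)+
    show "last xs \<noteq> hd xs"
      using xs(2) l last_conv_nth[of xs] hd_conv_nth[of xs]
        nth_eq_iff_index_eq[OF xs(2), of "length xs - 1" 0] by fastforce
  qed
  moreover have "successively (\<lambda>u v. (u, v) \<in> E) xs"
    using xs by (auto simp: successively_iff_nth nth_eq_iff_index_eq intro!: assms(3))
  ultimately show ?thesis using xs l by (auto simp: hamiltonian_def)
qed

text \<open>Degrees only grow under saturation, so a counterexample could be taken edge-maximal.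
  Degree condition and degree-sum bound then leave no nonadjacent pair, but a complete graph is
  Hamiltonian.\<close>

theorem Ore:
  assumes G: "sgraph V E" and n: "3 \<le> card V"
    and deg: "\<And>u v. u \<in> V \<Longrightarrow> v \<in> V \<Longrightarrow> u \<noteq> v \<Longrightarrow> (u, v) \<notin> E \<Longrightarrow> card V \<le> deg E u + deg E v"
  shows "hamiltonian V E"
proof (rule ccontr)
  assume "\<not> hamiltonian V E"
  then obtain F where F: "E \<subseteq> F" "edge_maximal_nonhamiltonian V F"
    using edge_maximal_nonhamiltonian_extension[OF G] by blast
  then have GF: "sgraph V F" and nh: "\<not> hamiltonian V F"
    by (auto simp: edge_maximal_nonhamiltonian_def)
  have "(u, v) \<in> F" if uv: "u \<in> V" "v \<in> V" "u \<noteq> v" for u v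
  proof (rule ccontr)
    assume nF: "(u, v) \<notin> F"
    have "deg E w \<le> deg F w" for w
      using F(1) sgraphD(3)[OF GF] by (intro card_mono) auto
    from this[of u] this[of v] show False
      using edge_maximal_nonhamiltonian_degree_sum[OF F(2) uv nF] deg[OF uv] nF F(1) by fastforce
  qed
  then show False using hamiltonian_complete[of V F] sgraphD(1)[OF G] n nh by blast
qed

subsection \<open>Saturated non-Hamiltonian graphs\<close>

text \<open>A vertex of degree below \<open>n / 2\<close> lacks at least \<open>(n - 1) / 2\<close>
  of its \<open>n - 1\<close> possible neighbours, while by \<open>size\<close> these deficits sum
  to at most \<open>2 * k * (n - 1)\<close>.\<close>

lemma card_low_degree_vertices:
  assumes G: "sgraph V E" and n: "card V = n" "1 < n"
    and size: "(real n - 1) * (real n - 2 * real k) \<le> real (card E)"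
  shows "card {v \<in> V. 2 * deg E v < n} \<le> 4 * k"
proof -
  define T where "T = {v \<in> V. 2 * deg E v < n}"
  have fV: "finite V" and TV: "T \<subseteq> V" using sgraphD(1)[OF G] by (auto simp: T_def)
  have t: "card T \<le> n" using n fV TV by (auto intro: card_mono)
  have "real (card E) = (\<Sum>v\<in>T. real (deg E v)) + (\<Sum>v\<in>V - T. real (deg E v))"
    using card_eq_sum_deg[OF G] sum.subset_diff[OF TV fV, of "\<lambda>v. real (deg E v)"] by simp
  also have "(\<Sum>v\<in>T. real (deg E v)) \<le> (\<Sum>v\<in>T. (real n - 1) / 2)"
    using n by (intro sum_mono) (auto simp: T_def field_simps)
  also have "(\<Sum>v\<in>V - T. real (deg E v)) \<le> (\<Sum>v\<in>V - T. real n - 1)"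
    using deg_less_card[OF G] n by (intro sum_mono) fastforce
  finally have "real (card E) \<le> real (card T) * ((real n - 1) / 2) + (real n - card T) * (real n - 1)"
    using t n fV TV by (simp add: card_Diff_subset finite_subset of_nat_diff)
  also have "\<dots> = (real n - 1) * (real n - card T / 2)" by (simp add: field_simps)
  finally have "(real n - 1) * (real n - 2 * real k) \<le> (real n - 1) * (real n - card T / 2)"
    using size by linarith
  then have "card T \<le> 4 * k" using n by (simp add: mult_le_cancel_left)
  then show ?thesis by (simp add: T_def)
qed

text \<open>\<open>E\<close>, the nonadjacent pairs between \<open>T\<close> and its complement in
  both orders, and the diagonal are disjoint parts of \<open>V \<times> V\<close>.\<close>

lemma card_nonadjacent_bound:
  assumes G: "sgraph V E" and TV: "T \<subseteq> V" and d: "\<And>v. v \<in> T \<Longrightarrow> deg E v \<le> d"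
  shows "real (card E) + 2 * (card T * (real (card V) - card T) - card T * d) + card V
    \<le> real (card V) ^ 2"
proof -
  note fV = sgraphD(1)[OF G] and fE = sgraphD(2)[OF G]
  have fT: "finite T" using fV TV finite_subset by blast
  define N where "N = T \<times> (V - T) - E"
  have fN: "finite N" using fV fT by (simp add: N_def)
  have "card (T \<times> (V - T) \<inter> E) \<le> card (Sigma T (\<lambda>v. E `` {v}))"
    using fT sgraphD(3)[OF G] by (intro card_mono) auto
  also have "\<dots> = (\<Sum>v\<in>T. deg E v)" using fT sgraphD(3)[OF G] by (subst card_SigmaI) auto
  also have "\<dots> \<le> card T * d" using sum_bounded_above[of T "deg E" d] d by simp
  finally have i: "card (T \<times> (V - T) \<inter> E) \<le> card T * d" .
  have "card (T \<times> (V - T)) = card N + card (T \<times> (V - T) \<inter> E)"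
    using fV fT card_Un_disjoint[of N "T \<times> (V - T) \<inter> E"]
    by (auto simp: N_def Un_Diff_Int)
  then have "real (card T * (card V - card T)) \<le> real (card N) + real (card T * d)"
    using i fT TV by (simp add: card_cartesian_product card_Diff_subset flip: of_nat_add of_nat_mult)
  then have N: "card T * (real (card V) - card T) - card T * d \<le> real (card N)"
    using card_mono[OF fV TV] by (simp add: of_nat_diff)
  have "card (E \<union> N \<union> N\<inverse> \<union> Id_on V) \<le> card (V \<times> V)"
    using fV G TV by (intro card_mono) (auto simp: N_def sgraph_def)
  moreover have "card (E \<union> N \<union> N\<inverse> \<union> Id_on V) = card E + card N + card (N\<inverse>) + card (Id_on V)"
  proof -
    have "card (E \<union> N \<union> N\<inverse> \<union> Id_on V) = card (E \<union> N \<union> N\<inverse>) + card (Id_on V)"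
      using fE fN fV sgraphD(7)[OF G]
      by (intro card_Un_disjoint) (auto simp: N_def Id_on_def)
    also have "card (E \<union> N \<union> N\<inverse>) = card (E \<union> N) + card (N\<inverse>)"
      using fE fN sgraphD(6)[OF G] by (intro card_Un_disjoint) (auto simp: N_def)
    also have "card (E \<union> N) = card E + card N"
      using fE fN by (intro card_Un_disjoint) (auto simp: N_def)
    finally show ?thesis .
  qed
  moreover have "card (Id_on V) = card V"
    by (auto simp: Id_on_def card_UN_disjoint fV)
  ultimately have "card E + 2 * card N + card V \<le> card V * card V"
    by (simp add: card_cartesian_product)
  then have "real (card E + 2 * card N + card V) \<le> real (card V * card V)"
    using of_nat_le_iff by blast
  then show ?thesis using N by (simp add: power2_eq_square)
qed

text \<open>Let \<open>T\<close> be the vertices of degree below \<open>n / 2\<close>; the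
  degree-sum bound makes \<open>V - T\<close> a clique. With \<open>t = card T\<close>, each vertex
  of \<open>T\<close> misses some \<open>u\<close> in \<open>V - T\<close>, and since
  \<open>u\<close> has degree at least \<open>n - t - 1\<close>, its own degree is at most
  \<open>t\<close>. So about \<open>t * n\<close> pairs are nonadjacent, while only about
  \<open>k * n\<close> may be; this forces \<open>t \<le> k\<close>, and the minimum degree gives
  \<open>k \<le> t\<close>.\<close>

lemma edge_maximal_nonhamiltonian_clique:
  assumes M: "edge_maximal_nonhamiltonian V E" and n: "card V = n"
    and k: "0 < k" "2 * k ^ 2 + 10 * k < n"
    and min: "\<And>v. v \<in> V \<Longrightarrow> k \<le> deg E v"
    and size: "(real n - 1) * (real n - 2 * real k) \<le> real (card E)"
  shows "\<exists>T\<subseteq>V. card T = k \<and> (\<forall>v\<in>T. deg E v = k)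
    \<and> (\<forall>u\<in>V - T. \<forall>v\<in>V - T. u \<noteq> v \<longrightarrow> (u, v) \<in> E)"
proof -
  have G: "sgraph V E" and nh: "\<not> hamiltonian V E"
    using M by (auto simp: edge_maximal_nonhamiltonian_def)
  note fV = sgraphD(1)[OF G]
  define T where "T = {v \<in> V. 2 * deg E v < n}"
  define t where "t = card T"
  have TV: "T \<subseteq> V" by (auto simp: T_def)
  have fT: "finite T" using TV fV finite_subset by blast
  have t4: "t \<le> 4 * k"
    unfolding t_def T_def using k by (intro card_low_degree_vertices[OF G n _ size]) simp
  have clique: "(u, v) \<in> E" if "u \<in> V - T" "v \<in> V - T" "u \<noteq> v" for u v
    using edge_maximal_nonhamiltonian_degree_sum[OF M, of u v] that n by (fastforce simp: T_def)
  have C: "card (V - T) = n - t" using fV TV fT n by (simp add: card_Diff_subset t_def)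
  have low: "deg E v \<le> t" if v: "v \<in> T" for v
  proof -
    have "\<not> V - T \<subseteq> E `` {v}"
    proof
      assume "V - T \<subseteq> E `` {v}"
      then have "n - t \<le> deg E v" using C card_mono[OF sgraphD(3)[OF G]] by metis
      then have "n < 2 * t" using v by (auto simp: T_def)
      then show False using t4 k by (simp add: power2_eq_square)
    qed
    then obtain u where u: "u \<in> V - T" "(v, u) \<notin> E" by auto
    have "card (V - T - {u}) \<le> deg E u"
      using clique[OF u(1)] sgraphD(3)[OF G] by (intro card_mono) auto
    then have "n - t - 1 \<le> deg E u" using C u(1) fV by simp
    moreover have "deg E v + deg E u < n"
      using edge_maximal_nonhamiltonian_degree_sum[OF M, of v u] u v n by (auto simp: T_def)
    ultimately show ?thesis by simp
  qed
  have "T \<noteq> {}"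
    using hamiltonian_complete[OF fV] clique nh n k by (auto simp: power2_eq_square)
  then have kt: "k \<le> t" using low min TV by (meson all_not_in_conv le_trans subsetD)
  have "t = k"
  proof (rule ccontr)
    assume "t \<noteq> k"
    define j where "j = t - k"
    have j: "t = k + j" "1 \<le> j" "j \<le> 3 * k" using \<open>t \<noteq> k\<close> kt t4 by (auto simp: j_def)
    have "real (card E) + 2 * (real t * (real n - t) - real t * t) + n \<le> real n ^ 2"
      using card_nonadjacent_bound[OF G TV low] n by (simp add: t_def)
    then have "(real t - k) * n \<le> 2 * real t ^ 2 - k"
      using size by (simp add: algebra_simps power2_eq_square)
    then have "real j * n \<le> 2 * (real k + j) ^ 2" by (simp add: j(1))
    also have "\<dots> = 2 * real k ^ 2 * 1 + real j * (4 * real k) + real j * (2 * real j)"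
      by (simp add: power2_eq_square algebra_simps)
    \<comment> \<open>The first term uses \<open>1 \<le> j\<close>, the last one
      \<open>j \<le> 3 * k\<close>. Here the constant \<open>2 * k ^ 2 + 10 * k\<close> arises, with
      \<open>10 = 4 + 6\<close>.\<close>
    also have "\<dots> \<le> 2 * real k ^ 2 * real j + real j * (4 * real k) + real j * (2 * (3 * real k))"
      using j by (intro add_mono mult_left_mono) auto
    also have "\<dots> = real j * (2 * real k ^ 2 + 10 * k)" by (simp add: algebra_simps)
    also have "\<dots> < real j * n"
      using j k(2) by (intro mult_strict_left_mono) (simp_all flip: of_nat_power of_nat_less_iff)
    finally show False by simp
  qed
  then show ?thesis
    using TV low min clique by (intro exI[of _ T]) (auto simp: t_def intro!: antisym)
qed

lemma hamiltonian_cycle_ending_at: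
  assumes "hamiltonian V E" "w \<in> V"
  shows "\<exists>xs. distinct xs \<and> set xs = V \<and> 3 \<le> length xs
     \<and> successively (\<lambda>u v. (u, v) \<in> E) xs \<and> (last xs, hd xs) \<in> E \<and> last xs = w"
proof -
  obtain xs where xs: "distinct xs" "set xs = V" "3 \<le> length xs"
    "successively (\<lambda>u v. (u, v) \<in> E) xs" "(last xs, hd xs) \<in> E"
    using assms(1) by (auto simp: hamiltonian_def)
  obtain as bs where xs_eq: "xs = (as @ [w]) @ bs" using split_list assms(2) xs(2) by fastforce
  show ?thesis
  proof (cases "bs = []")
    case True
    then show ?thesis using xs xs_eq by (intro exI[of _ xs]) auto
  next
    case False
    have "hd (as @ [w]) = hd xs" "last xs = last bs" using xs_eq False by (auto simp: hd_append)
    then have "successively (\<lambda>u v. (u, v) \<in> E) (bs @ (as @ [w]))" "(w, hd bs) \<in> E"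
      using xs(4,5) False unfolding xs_eq by (auto simp: successively_append_iff successively_Cons)
    then show ?thesis
      using xs(1-3) False unfolding xs_eq by (intro exI[of _ "bs @ (as @ [w])"]) auto
  qed
qed

text \<open>If \<open>Y\<close> is neither a single vertex nor as large as \<open>T\<close>, Ore's theorem gives a Hamiltonian cycle of
  \<open>T\<close> together with all but one vertex \<open>y\<close> of \<open>Y\<close>; the remaining vertices, ending with \<open>y\<close>, are inserted
  after a vertex of \<open>Y\<close>.\<close>

lemma hamiltonian_if_intermediate:
  assumes G: "sgraph V E" and T: "T \<subseteq> V" "card T = k" and Y: "Y \<subset> V - T" "2 \<le> card Y" "card Y < k"
    and deg: "\<And>v. v \<in> T \<Longrightarrow> deg E v = k"
    and nb: "\<And>v. v \<in> T \<Longrightarrow> E `` {v} - T = Y"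
    and clique: "\<And>u v. u \<in> V - T \<Longrightarrow> v \<in> V - T \<Longrightarrow> u \<noteq> v \<Longrightarrow> (u, v) \<in> E"
  shows "hamiltonian V E"
proof -
  note fV = sgraphD(1)[OF G] and sy = sgraphD(6)[OF G]
  have fin: "finite T" "finite Y" using fV T(1) Y(1) by (auto intro: finite_subset)
  obtain y where y: "y \<in> Y" using Y(2) by fastforce
  have "card (Y - {y}) \<noteq> 0" using Y(2) y fin by simp
  then have "Y - {y} \<noteq> {}" by force
  then obtain w where w: "w \<in> Y" "w \<noteq> y" by blast
  define W where "W = T \<union> (Y - {y})"
  define F where "F = E \<inter> W \<times> W"
  have GF: "sgraph W F"
    using G fin by (auto simp: sgraph_def F_def W_def irrefl_def sym_def)
  have cW: "card W = k + card Y - 1"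
    using T(2) Y y fin unfolding W_def by (subst card_Un_disjoint) auto
  have TY: "(u, v) \<in> E" "(v, u) \<in> E" if "u \<in> T" "v \<in> Y" for u v
    using nb[OF that(1)] that(2) sy by blast+
  have "hamiltonian W F"
  proof (rule Ore[OF GF])
    show "3 \<le> card W" using cW Y by linarith
    fix u v assume uv: "u \<in> W" "v \<in> W" "u \<noteq> v" "(u, v) \<notin> F"
    \<comment> \<open>Leaving out \<open>y\<close> costs every vertex of \<open>T\<close> exactly
      one neighbour. Nonadjacent vertices of \<open>W\<close> both lie in \<open>T\<close>, so Ore's
      condition reads \<open>k + card Y - 1 \<le> 2 * (k - 1)\<close>, that is,
      \<open>card Y < k\<close>.\<close>
    have dF: "deg F v = k - 1" if "v \<in> T" for v
    proof -
      have "F `` {v} = E `` {v} - {y}"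
        using that nb[OF that] y sgraphD(7)[OF G] by (auto simp: F_def W_def)
      then show ?thesis using deg[OF that] TY(1)[OF that y] sgraphD(3)[OF G] by simp
    qed
    have "(u, v) \<notin> E" "u \<in> T \<or> u \<in> Y" "v \<in> T \<or> v \<in> Y"
      using uv by (auto simp: F_def W_def)
    then have "u \<in> T \<and> v \<in> T" using uv(3) TY clique[of u v] Y(1) by blast
    then show "card W \<le> deg F u + deg F v" using dF cW Y(3) by auto
  qed
  then obtain xs where xs: "distinct xs" "set xs = W" "3 \<le> length xs"
    "successively (\<lambda>u v. (u, v) \<in> F) xs" "(last xs, hd xs) \<in> F" "last xs = w"
    using hamiltonian_cycle_ending_at[of W F w] w by (auto simp: W_def)
  have "finite (V - T - Y)" using fV by simp
  then obtain zs where zs: "set zs = V - T - Y" "distinct zs" using finite_distinct_list by blast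
  have zne: "zs \<noteq> []" using zs Y(1) by fastforce
  have hz: "hd zs \<in> V - T - Y" "last zs \<in> V - T - Y" using zne zs by (metis hd_in_set last_in_set)+
  have sz: "successively (\<lambda>u v. (u, v) \<in> E) zs"
    unfolding successively_iff_nth
  proof (intro allI impI clique)
    fix i assume i: "Suc i < length zs"
    then have "zs ! i \<in> set zs" "zs ! Suc i \<in> set zs" by auto
    then show "zs ! i \<in> V - T" "zs ! Suc i \<in> V - T" using zs by auto
    show "zs ! i \<noteq> zs ! Suc i" using i zs(2) by (simp add: nth_eq_iff_index_eq)
  qed
  have xne: "xs \<noteq> []" using xs(3) by auto
  then have "hd xs \<in> W" using xs(2) by auto
  then have "hd xs \<in> T \<or> hd xs \<in> Y \<and> hd xs \<noteq> y" by (auto simp: W_def)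
  then have "(y, hd xs) \<in> E"
    using TY(2)[OF _ y] y clique[of y "hd xs"] Y(1) by blast
  moreover have "successively (\<lambda>u v. (u, v) \<in> E) xs"
    using xs(4) by (rule successively_mono) (auto simp: F_def)
  moreover have "(w, hd zs) \<in> E" "(last zs, y) \<in> E"
    using hz w y Y(1) by (auto intro!: clique)
  ultimately have "successively (\<lambda>u v. (u, v) \<in> E) (xs @ zs @ [y])"
    "(last (xs @ zs @ [y]), hd (xs @ zs @ [y])) \<in> E"
    using xne zne sz xs(6) by (auto simp: successively_append_iff)
  moreover have "set (xs @ zs @ [y]) = V" using xs(2) zs(1) y Y(1) T(1) by (auto simp: W_def)
  moreover have "distinct (xs @ zs @ [y])" using xs(1,2) zs y Y(1) by (auto simp: W_def)
  ultimately show ?thesis using xs(3) unfolding hamiltonian_def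
    by (intro exI[of _ "xs @ zs @ [y]"]) auto
qed

text \<open>In the saturated graph a clique vertex with one neighbour in \<open>T\<close> has degree
  at least \<open>n - k\<close>; by the degree-sum bound it is adjacent to all of \<open>T\<close>,
  whose vertices have degree \<open>k\<close>. Thus \<open>Y\<close> is common to all of
  \<open>T\<close>, and each vertex of \<open>T\<close> has \<open>k - card Y\<close> neighbours
  inside \<open>T\<close>: none if \<open>card Y = k\<close>, all the others if
  \<open>card Y = 1\<close>. Connectivity excludes \<open>Y = {}\<close>.\<close>

theorem nonhamiltonian_structure:
  assumes G: "sgraph V E" and nh: "\<not> hamiltonian V E" and n: "card V = n"
    and k: "0 < k" "2 * k ^ 2 + 10 * k < n"
    and min: "\<And>v. v \<in> V \<Longrightarrow> k \<le> deg E v"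
    and size: "(real n - 1) * (real n - 2 * real k) \<le> real (card E)"
    and conn: "\<And>S. S \<subset> V \<Longrightarrow> S \<noteq> {} \<Longrightarrow> \<exists>u\<in>S. \<exists>v\<in>V - S. (u, v) \<in> E"
  shows "\<exists>X Y. X \<subseteq> V \<and> Y \<subseteq> V - X \<and> card X = k
    \<and> (card Y = k \<and> (\<forall>v\<in>X. E `` {v} = Y) \<or> card Y = 1 \<and> (\<forall>v\<in>X. E `` {v} = Y \<union> (X - {v})))"
proof -
  obtain F where EF: "E \<subseteq> F" and M: "edge_maximal_nonhamiltonian V F"
    using edge_maximal_nonhamiltonian_extension[OF G nh] by blast
  then have GF: "sgraph V F" and nhF: "\<not> hamiltonian V F"
    by (auto simp: edge_maximal_nonhamiltonian_def)
  note fV = sgraphD(1)[OF GF] and sy = sgraphD(6)[OF GF]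
  have mono: "deg E v \<le> deg F v" for v using EF sgraphD(3)[OF GF] by (intro card_mono) auto
  have minF: "k \<le> deg F v" if "v \<in> V" for v using min[OF that] mono[of v] by simp
  have sizeF: "(real n - 1) * (real n - 2 * real k) \<le> real (card F)"
    using size card_mono[OF sgraphD(2)[OF GF] EF] by linarith
  obtain T where T: "T \<subseteq> V" "card T = k" and deg: "\<And>v. v \<in> T \<Longrightarrow> deg F v = k"
    and clique: "\<And>u v. u \<in> V - T \<Longrightarrow> v \<in> V - T \<Longrightarrow> u \<noteq> v \<Longrightarrow> (u, v) \<in> F"
    using edge_maximal_nonhamiltonian_clique[OF M n k minF sizeF] by blast
  have fT: "finite T" using fV T(1) finite_subset by blast
  have kn: "4 * k < n" using k by (simp add: power2_eq_square)
  have nbE: "E `` {v} = F `` {v}" if "v \<in> T" for v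
    using EF deg[OF that] min[of v] that T(1) by (intro card_seteq[OF sgraphD(3)[OF GF]]) auto
  define Y where "Y = {u \<in> V - T. \<exists>v\<in>T. (v, u) \<in> F}"
  have nb: "F `` {v} - T = Y" if v: "v \<in> T" for v
  proof
    show "F `` {v} - T \<subseteq> Y" using v sgraphD(5)[OF GF] by (auto simp: Y_def)
    show "Y \<subseteq> F `` {v} - T"
    proof
      fix u assume "u \<in> Y"
      then obtain v' where u: "u \<in> V - T" "v' \<in> T" "(v', u) \<in> F" by (auto simp: Y_def)
      have "(v, u) \<in> F"
      proof (rule ccontr)
        assume "(v, u) \<notin> F"
        then have "deg F v + deg F u < n"
          using edge_maximal_nonhamiltonian_degree_sum[OF M, of v u] u v T n by auto
        moreover have "card (insert v' (V - T - {u})) \<le> deg F u"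
          using clique[OF u(1)] sy u sgraphD(3)[OF GF] by (intro card_mono) auto
        moreover have "card (insert v' (V - T - {u})) = n - k"
          using u fV T fT n kn by (simp add: card_Diff_subset)
        ultimately show False using deg[OF v] kn by simp
      qed
      then show "u \<in> F `` {v} - T" using u by auto
    qed
  qed
  obtain v0 where v0: "v0 \<in> T" using T(2) k by fastforce
  have fY: "finite Y" using fV by (auto simp: Y_def)
  have yk: "card Y \<le> k" using nb[OF v0] deg[OF v0] sgraphD(3)[OF GF] card_mono
    by (metis Diff_subset)
  have "Y \<noteq> {}"
  proof
    assume "Y = {}"
    have "T \<subset> V" "T \<noteq> {}" using T v0 n kn by auto
    then obtain u v where "u \<in> T" "v \<in> V - T" "(u, v) \<in> E" using conn by blast
    then show False using \<open>Y = {}\<close> EF by (auto simp: Y_def)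
  qed
  then have y1: "1 \<le> card Y" using fY by (simp add: Suc_leI card_gt_0_iff)
  have YT: "Y \<subset> V - T"
  proof -
    have "card (V - T) = n - k" using fV fT T n by (simp add: card_Diff_subset)
    then show ?thesis using yk kn by (auto simp: Y_def)
  qed
  have inT: "card (F `` {v} \<inter> T) = k - card Y" if "v \<in> T" for v
  proof -
    have "card (F `` {v}) = card (F `` {v} \<inter> T) + card (F `` {v} - T)"
      using sgraphD(3)[OF GF] by (metis card_Int_Diff)
    then show ?thesis using nb[OF that] deg[OF that] by simp
  qed
  have "\<not> (2 \<le> card Y \<and> card Y < k)"
    using hamiltonian_if_intermediate[OF GF T YT _ _ deg nb clique] nhF by blast
  then consider "card Y = k" | "card Y = 1" using yk y1 by linarith
  then have "card Y = k \<and> (\<forall>v\<in>T. F `` {v} = Y) \<or> card Y = 1 \<and> (\<forall>v\<in>T. F `` {v} = Y \<union> (T - {v}))"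
  proof cases
    case 1
    then have "F `` {v} \<inter> T = {}" if "v \<in> T" for v using inT[OF that] fT by simp
    then show ?thesis using 1 nb by blast
  next
    case 2
    have "F `` {v} \<inter> T = T - {v}" if "v \<in> T" for v
      using inT[OF that] 2 that T fT sgraphD(7)[OF GF] by (intro card_subset_eq) auto
    then show ?thesis using 2 nb by blast
  qed
  then show ?thesis using T YT nbE by (intro exI[of _ T] exI[of _ Y]) auto
qed

subsection \<open>Signless Laplacian eigenvectors\<close>

lemma sum_arcs:
  assumes "sgraph V E"
  shows "(\<Sum>(u, v)\<in>E. f u v) = (\<Sum>u\<in>V. \<Sum>v\<in>E `` {u}. f u v)"
proof -
  have "E = Sigma V (\<lambda>v. E `` {v})" using sgraphD(4)[OF assms] by auto
  then show ?thesis using sum.Sigma[of V "\<lambda>v. E `` {v}" f] sgraphD(1,3)[OF assms] by simp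
qed

lemma sum_arcs_swap:
  assumes "sym E"
  shows "(\<Sum>(u, v)\<in>E. f v u) = (\<Sum>(u, v)\<in>E. f u v)"
proof -
  have "bij_betw prod.swap E E"
    using assms by (intro bij_betw_byWitness[of _ prod.swap]) (auto dest: symD)
  from sum.reindex_bij_betw[OF this, of "\<lambda>(u, v). f u v"] show ?thesis
    by (simp add: case_prod_beta prod.swap_def)
qed

text \<open>Eigenvectors are functions on vertices, so that the enumeration behind the matrix
  disappears from the estimates.\<close>

definition signless_eigenvector :: "'a set \<Rightarrow> ('a \<times> 'a) set \<Rightarrow> real \<Rightarrow> ('a \<Rightarrow> real) \<Rightarrow> bool" where
  "signless_eigenvector V E q x \<longleftrightarrow> (\<exists>v\<in>V. x v \<noteq> 0)
     \<and> (\<forall>v\<in>V. real (deg E v) * x v + (\<Sum>u\<in>E `` {v}. x u) = q * x v)"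

text \<open>The eigenvalue equation for \<open>D + A\<close>, conjugated by \<open>D\<close>, is evaluated where \<open>\<bar>x v\<bar> / deg v\<close> is
  largest.\<close>

lemma eigenvalue_le_degree_sum:
  assumes G: "sgraph V E" and d: "\<And>v. v \<in> V \<Longrightarrow> 0 < deg E v"
    and ev: "signless_eigenvector V E q x"
  shows "\<exists>v\<in>V. q * deg E v \<le> real (deg E v) ^ 2 + (\<Sum>u\<in>E `` {v}. real (deg E u))"
proof -
  define y where "y v = \<bar>x v\<bar> / deg E v" for v
  have xy: "\<bar>x v\<bar> = deg E v * y v" if "v \<in> V" for v using d[OF that] by (simp add: y_def)
  obtain w where w: "w \<in> V" "x w \<noteq> 0" using ev by (auto simp: signless_eigenvector_def)
  have fin: "finite (y ` V)" and ne: "y ` V \<noteq> {}" using sgraphD(1)[OF G] w by auto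
  obtain v where v: "v \<in> V" "y v = Max (y ` V)" using Max_in[OF fin ne] by (metis imageE)
  have max: "y u \<le> y v" if "u \<in> V" for u
    using that v(2) fin by auto
  have "0 < y w" using w d[OF w(1)] by (simp add: y_def)
  then have pos: "0 < y v" using max[OF w(1)] by linarith
  have "q * x v = real (deg E v) * x v + (\<Sum>u\<in>E `` {v}. x u)"
    using ev v(1) by (simp add: signless_eigenvector_def)
  then have "q * \<bar>x v\<bar> \<le> real (deg E v) * \<bar>x v\<bar> + (\<Sum>u\<in>E `` {v}. \<bar>x u\<bar>)"
    using sum_abs[of x "E `` {v}"] by (cases "0 \<le> x v") (auto simp: abs_if algebra_simps split: if_splits)
  also have "(\<Sum>u\<in>E `` {v}. \<bar>x u\<bar>) \<le> (\<Sum>u\<in>E `` {v}. deg E u * y v)"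
  proof (rule sum_mono)
    fix u assume "u \<in> E `` {v}"
    then have "u \<in> V" using sgraphD(5)[OF G] by auto
    then show "\<bar>x u\<bar> \<le> deg E u * y v" using xy max by (simp add: mult_left_mono)
  qed
  also have "\<dots> = (\<Sum>u\<in>E `` {v}. real (deg E u)) * y v" by (simp add: sum_distrib_right)
  finally have "(q * deg E v) * y v
      \<le> (real (deg E v) ^ 2 + (\<Sum>u\<in>E `` {v}. real (deg E u))) * y v"
    using xy[OF v(1)] by (simp add: algebra_simps power2_eq_square)
  then show ?thesis using pos v(1) by (auto simp: mult_le_cancel_right)
qed

text \<open>For the vertex \<open>v\<close> of the degree-sum bound,
  \<open>S \<le> D * (n - 1)\<close> confines \<open>D\<close> to the interval from
  \<open>n - 2 * k - 1\<close> to \<open>n - 1\<close>. The closed neighbourhood of \<open>v\<close>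
  contributes \<open>D + S\<close> to \<open>card E\<close>, and each of the remaining
  \<open>n - 1 - D\<close> vertices at least 1.\<close>

lemma eigenvalue_size_bound:
  assumes G: "sgraph V E" and n: "card V = n" and d: "\<And>v. v \<in> V \<Longrightarrow> 0 < deg E v"
    and ev: "signless_eigenvector V E q x" and q: "2 * (real n - real k - 1) \<le> q"
  shows "(real n - 1) * (real n - 2 * real k) \<le> real (card E)"
proof -
  obtain v where v: "v \<in> V"
    and le: "q * deg E v \<le> real (deg E v) ^ 2 + (\<Sum>u\<in>E `` {v}. real (deg E u))"
    using eigenvalue_le_degree_sum[OF G d ev] by blast
  define D where "D = real (deg E v)"
  define S where "S = (\<Sum>u\<in>E `` {v}. real (deg E u))"
  have D0: "0 < D" using d[OF v] by (simp add: D_def)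
  note fV = sgraphD(1)[OF G]
  have lt: "real (deg E u) \<le> real n - 1" if "u \<in> V" for u
    using deg_less_card[OF G that] n by linarith
  have "S \<le> (\<Sum>u\<in>E `` {v}. real n - 1)"
    unfolding S_def using lt sgraphD(5)[OF G] by (intro sum_mono) auto
  then have "S \<le> D * (real n - 1)" by (simp add: D_def)
  then have "D * q \<le> D * (D + (real n - 1))" using le
    by (simp add: S_def[symmetric] D_def[symmetric] algebra_simps power2_eq_square)
  then have D1: "real n - 2 * real k - 1 \<le> D" using q D0 by simp
  have D2: "D \<le> real n - 1" using lt[OF v] by (simp add: D_def)
  define R where "R = V - insert v (E `` {v})"
  have sub: "insert v (E `` {v}) \<subseteq> V" and nv: "v \<notin> E `` {v}"
    using v sgraphD(5,7)[OF G] by auto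
  have fN: "finite (E `` {v})" by (rule sgraphD(3)[OF G])
  have "real (card R) = real n - 1 - D"
    unfolding R_def using sub nv fN n card_mono[OF fV sub] by (subst card_Diff_subset) (auto simp: D_def of_nat_diff)
  moreover have "(\<Sum>u\<in>R. 1) \<le> (\<Sum>u\<in>R. real (deg E u))"
    using d by (intro sum_mono) (auto simp: R_def Suc_le_eq)
  moreover have "real (card E) = (\<Sum>u\<in>R. real (deg E u)) + (D + S)"
    using card_eq_sum_deg[OF G] sum.subset_diff[OF sub fV, of "\<lambda>u. real (deg E u)"] nv fN
    by (simp add: R_def D_def S_def)
  ultimately have "real n - 1 + S \<le> real (card E)" by simp
  moreover have "D * (2 * (real n - real k - 1)) \<le> D * q" using D0 q by simp
  then have "D * (2 * (real n - real k - 1)) \<le> D ^ 2 + S"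
    using le by (simp add: D_def S_def mult.commute)
  \<comment> \<open>The parabola \<open>2 * (n - k - 1) * D - D^2\<close>, a lower bound for
    \<open>S\<close>, takes the value \<open>(n - 1) * (n - 2 * k - 1)\<close> at both ends of the
    interval for \<open>D\<close>, hence at least this value inside.\<close>
  moreover have "0 \<le> (real n - 1 - D) * (D - (real n - 2 * real k - 1))"
    using D1 D2 by simp
  ultimately show ?thesis by (simp add: algebra_simps power2_eq_square)
qed

section \<open>The quadratic form of \<open>D + A\<close> and the energy of the exceptional
  structure\<close>

lemma sum_arcs_eigenvector:
  assumes G: "sgraph V E" and ev: "signless_eigenvector V E q x"
  shows "(\<Sum>(u, v)\<in>E. (x u + x v)\<^sup>2) = 2 * q * (\<Sum>v\<in>V. (x v)\<^sup>2)"
proof -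
  have "sym E" using G by (simp add: sgraph_def)
  have "(\<Sum>(u, v)\<in>E. (x u + x v)\<^sup>2)
      = (\<Sum>(u, v)\<in>E. (x u)\<^sup>2) + (\<Sum>(u, v)\<in>E. (x v)\<^sup>2) + 2 * (\<Sum>(u, v)\<in>E. x u * x v)"
    unfolding split_def by (simp only: power2_sum sum.distrib sum_distrib_left mult.assoc)
  also have "\<dots> = 2 * ((\<Sum>(u, v)\<in>E. (x u)\<^sup>2) + (\<Sum>(u, v)\<in>E. x u * x v))"
    using sum_arcs_swap[OF \<open>sym E\<close>, of "\<lambda>u v. (x u)\<^sup>2"] by simp
  also have "(\<Sum>(u, v)\<in>E. (x u)\<^sup>2) + (\<Sum>(u, v)\<in>E. x u * x v)
      = (\<Sum>v\<in>V. x v * (deg E v * x v + (\<Sum>u\<in>E `` {v}. x u)))"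
    unfolding sum_arcs[OF G] sum.distrib[symmetric]
    by (intro sum.cong refl) (simp add: sum.distrib sum_distrib_left distrib_left power2_eq_square)
  also have "\<dots> = (\<Sum>v\<in>V. x v * (q * x v))"
    using ev by (intro sum.cong) (auto simp: signless_eigenvector_def)
  finally show ?thesis by (simp add: sum_distrib_left power2_eq_square mult_ac)
qed

lemma sum_pairs_power2:
  fixes x :: "'a \<Rightarrow> real"
  assumes "finite C"
  shows "(\<Sum>(u, v)\<in>C \<times> C - Id. (x u + x v)\<^sup>2)
    = 2 * (real (card C) - 2) * (\<Sum>v\<in>C. (x v)\<^sup>2) + 2 * (\<Sum>v\<in>C. x v)\<^sup>2"
proof -
  have Id: "Id_on C = (\<lambda>v. (v, v)) ` C" by (auto simp: Id_on_def)
  have "(\<Sum>(u, v)\<in>C \<times> C. (x u + x v)\<^sup>2)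
      = 2 * real (card C) * (\<Sum>v\<in>C. (x v)\<^sup>2) + 2 * (\<Sum>v\<in>C. x v)\<^sup>2"
    unfolding sum.cartesian_product[symmetric] power2_sum sum.distrib
    by (simp add: power2_eq_square[of "sum x C"] sum_distrib_left[symmetric]
        sum_distrib_right[symmetric] mult.assoc)
  moreover have "(\<Sum>(u, v)\<in>C \<times> C. (x u + x v)\<^sup>2)
      = (\<Sum>(u, v)\<in>C \<times> C - Id. (x u + x v)\<^sup>2) + (\<Sum>(u, v)\<in>Id_on C. (x u + x v)\<^sup>2)"
    using assms by (subst sum.union_disjoint[symmetric]) (auto simp: Id intro!: sum.cong)
  moreover have "(\<Sum>(u, v)\<in>Id_on C. (x u + x v)\<^sup>2) = 4 * (\<Sum>v\<in>C. (x v)\<^sup>2)"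
    unfolding Id by (simp add: sum.reindex inj_on_def sum_distrib_left)
  ultimately show ?thesis by (simp add: algebra_simps)
qed

lemma weighted_power2_add_le:
  fixes a b r :: real
  assumes "0 < r"
  shows "(a + b)\<^sup>2 \<le> (1 + r) * a\<^sup>2 + (1 + 1 / r) * b\<^sup>2"
proof -
  have "0 \<le> (r * a - b)\<^sup>2 / r" using assms by simp
  also have "\<dots> = (1 + r) * a\<^sup>2 + (1 + 1 / r) * b\<^sup>2 - (a + b)\<^sup>2"
    using assms by (simp add: power2_eq_square field_simps)
  finally show ?thesis by simp
qed

text \<open>For the clique on \<open>C\<close>, the bound \<open>2 * (card C - 1)\<close> is the
  largest eigenvalue, and comparing forms leaves \<open>card C\<close> times the square sum minus
  the squared sum. Young's inequality with the free weight \<open>p\<close> splits the edges between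
  \<open>X\<close> and \<open>Y\<close>: a vertex of \<open>X\<close> receives \<open>y + p\<close>,
  a vertex of \<open>Y\<close> receives \<open>k * (1 + y / p)\<close>. Edges inside
  \<open>X\<close> add at most \<open>2 * r\<close> per vertex. As \<open>q\<close> exceeds
  \<open>p + y + 2 * r\<close> by at least 1, one copy of the square sum over \<open>X\<close>
  remains on the left.\<close>

lemma exceptional_energy:
  fixes p q :: real
  assumes G: "sgraph V E" and ev: "signless_eigenvector V E q x"
    and X: "X \<subseteq> V" "card X = k" and Y: "Y \<subseteq> V - X" "card Y = y" "0 < y"
    and nb: "\<And>u. u \<in> X \<Longrightarrow> E `` {u} - X = Y" and r: "\<And>u. u \<in> X \<Longrightarrow> card (E `` {u} \<inter> X) = r"
    and q: "2 * (real (card (V - X)) - 1) \<le> q" "p + y + 2 * real r + 1 \<le> q" and p: "0 < p"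
  defines "C \<equiv> V - X"
  defines "F \<equiv> C \<times> C - Id - E"
  shows "real (card C) * (\<Sum>v\<in>C. (x v)\<^sup>2) - (\<Sum>v\<in>C. x v)\<^sup>2
      + (\<Sum>(u, v)\<in>F. (x u + x v)\<^sup>2) / 2 + (\<Sum>v\<in>X. (x v)\<^sup>2)
    \<le> k * (1 + y / p) * (\<Sum>v\<in>Y. (x v)\<^sup>2)"
proof -
  let ?f = "\<lambda>(u, v). (x u + x v)\<^sup>2"
  note fV = sgraphD(1)[OF G] and fE = sgraphD(2)[OF G]
  have fin: "finite X" "finite C" "finite Y" using fV X(1) Y(1) by (auto simp: C_def intro: finite_subset)
  have V: "(\<Sum>v\<in>V. (x v)\<^sup>2) = (\<Sum>v\<in>C. (x v)\<^sup>2) + (\<Sum>v\<in>X. (x v)\<^sup>2)"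
    using sum.subset_diff[OF X(1) fV] by (simp add: C_def)
  have "E = (E \<inter> C \<times> C) \<union> (X \<times> Y) \<union> (X \<times> Y)\<inverse> \<union> (E \<inter> X \<times> X)" (is "_ = ?A \<union> ?B \<union> ?B' \<union> ?D")
  proof -
    have "(u, v) \<in> E \<longleftrightarrow> v \<in> Y" "(v, u) \<in> E \<longleftrightarrow> v \<in> Y" if "u \<in> X" "v \<notin> X" for u v
      using nb[OF that(1)] that sgraphD(6)[OF G] by blast+
    then show ?thesis
      using Y(1) sgraphD(4,5)[OF G] by (auto simp: C_def)
  qed
  then have "sum ?f E = sum ?f (?A \<union> ?B \<union> ?B' \<union> ?D)" by simp
  also have "\<dots> = sum ?f ?A + sum ?f ?B + sum ?f ?B' + sum ?f ?D"
    using fin fE Y(1) by (subst sum.union_disjoint; (subst sum.union_disjoint)?; (subst sum.union_disjoint)?)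
      (auto simp: C_def)
  also have "sum ?f ?B' = sum ?f ?B"
    by (rule sum.reindex_bij_witness[of _ prod.swap prod.swap]) (auto simp: add.commute)
  also have "sum ?f ?A = sum ?f (C \<times> C - Id) - sum ?f F"
  proof -
    have "C \<times> C - Id = ?A \<union> F" using sgraphD(7)[OF G] by (auto simp: F_def)
    moreover have "sum ?f (?A \<union> F) = sum ?f ?A + sum ?f F"
      using fin by (intro sum.union_disjoint) (auto simp: F_def)
    ultimately show ?thesis by simp
  qed
  also have "sum ?f ?D \<le> 4 * real r * (\<Sum>v\<in>X. (x v)\<^sup>2)"
  proof -
    have GD: "sgraph X ?D" using G fin by (auto simp: sgraph_def sym_def irrefl_def)
    have "sum ?f ?D \<le> (\<Sum>(u, v)\<in>?D. 2 * (x u)\<^sup>2 + 2 * (x v)\<^sup>2)"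
      by (intro sum_mono) (use weighted_power2_add_le[of 1] in auto)
    also have "\<dots> = 2 * (\<Sum>(u, v)\<in>?D. (x u)\<^sup>2) + 2 * (\<Sum>(u, v)\<in>?D. (x v)\<^sup>2)"
      unfolding split_def by (simp only: sum.distrib sum_distrib_left)
    also have "\<dots> = 4 * (\<Sum>(u, v)\<in>?D. (x u)\<^sup>2)"
      using sum_arcs_swap[of ?D "\<lambda>u v. (x u)\<^sup>2"] GD by (simp add: sgraph_def)
    also have "(\<Sum>(u, v)\<in>?D. (x u)\<^sup>2) = (\<Sum>u\<in>X. r * (x u)\<^sup>2)"
    proof -
      have "?D `` {u} = E `` {u} \<inter> X" if "u \<in> X" for u using that by auto
      then show ?thesis using r by (simp add: sum_arcs[OF GD])
    qed
    finally show ?thesis by (simp add: sum_distrib_left mult.assoc)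
  qed
  also have "sum ?f ?B \<le> k * (1 + y / p) * (\<Sum>v\<in>Y. (x v)\<^sup>2) + (y + p) * (\<Sum>v\<in>X. (x v)\<^sup>2)"
  proof -
    have "sum ?f ?B \<le> (\<Sum>(u, v)\<in>?B. (1 + p / y) * (x u)\<^sup>2 + (1 + 1 / (p / y)) * (x v)\<^sup>2)"
      by (intro sum_mono) (use weighted_power2_add_le[of "p / y"] p Y(3) in auto)
    also have "\<dots> = k * (1 + y / p) * (\<Sum>v\<in>Y. (x v)\<^sup>2) + y * (1 + p / y) * (\<Sum>v\<in>X. (x v)\<^sup>2)"
      using X(2) Y(2) by (simp add: sum.cartesian_product[symmetric] sum.distrib sum_distrib_left[symmetric]
          mult.assoc)
    finally show ?thesis using Y(3) by (simp add: distrib_left)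
  qed
  finally have "sum ?f E \<le> sum ?f (C \<times> C - Id) - sum ?f F
      + 2 * (k * (1 + y / p) * (\<Sum>v\<in>Y. (x v)\<^sup>2) + (y + p) * (\<Sum>v\<in>X. (x v)\<^sup>2))
      + 4 * real r * (\<Sum>v\<in>X. (x v)\<^sup>2)" by simp
  then have "2 * q * ((\<Sum>v\<in>C. (x v)\<^sup>2) + (\<Sum>v\<in>X. (x v)\<^sup>2))
    \<le> 2 * (real (card C) - 2) * (\<Sum>v\<in>C. (x v)\<^sup>2) + 2 * (\<Sum>v\<in>C. x v)\<^sup>2 - sum ?f F
      + 2 * (k * (1 + y / p) * (\<Sum>v\<in>Y. (x v)\<^sup>2) + (y + p) * (\<Sum>v\<in>X. (x v)\<^sup>2))
      + 4 * real r * (\<Sum>v\<in>X. (x v)\<^sup>2)"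
    by (simp only: sum_arcs_eigenvector[OF G ev] V sum_pairs_power2[OF fin(2)])
  moreover have "2 * (real (card C) - 1) * (\<Sum>v\<in>C. (x v)\<^sup>2) \<le> q * (\<Sum>v\<in>C. (x v)\<^sup>2)"
    using q(1) by (intro mult_right_mono) (auto simp: C_def sum_nonneg)
  moreover have "(p + y + 2 * real r + 1) * (\<Sum>v\<in>X. (x v)\<^sup>2) \<le> q * (\<Sum>v\<in>X. (x v)\<^sup>2)"
    using q(2) by (intro mult_right_mono) (auto simp: sum_nonneg)
  moreover have "s * A - M + N / 2 + B \<le> K"
    if "2 * q * (A + B) \<le> 2 * (s - 2) * A + 2 * M - N + 2 * (K + (y + p) * B) + 4 * real r * B"
      "2 * (s - 1) * A \<le> q * A" "(p + y + 2 * real r + 1) * B \<le> q * B" for A B M N K s :: real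
  proof -
    have "2 * (q * A) + 2 * (q * B) \<le> 2 * (s * A) - 4 * A + 2 * M - N + 2 * K
        + 2 * (y * B) + 2 * (p * B) + 4 * (r * B)"
      using that(1) by (simp add: algebra_simps)
    moreover have "2 * (s * A) - 2 * A \<le> q * A" using that(2) by (simp only: algebra_simps)
    moreover have "p * B + y * B + 2 * (r * B) + B \<le> q * B"
      using that(3) by (simp only: distrib_right mult_1_left mult.assoc)
    ultimately show ?thesis by linarith
  qed
  ultimately show ?thesis by blast
qed

text \<open>Writing \<open>x = a + e\<close> with \<open>a\<close> the mean of \<open>x\<close> on \<open>C\<close>, the first two energy terms amount to
  \<open>\<bar>C\<bar>\<close> times the sum of the \<open>e\<^sup>2\<close>. The weights \<open>l\<close> and \<open>r\<close> of Young's inequality are spent on the mixed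
  terms \<open>a e\<close> over \<open>F\<close> and over \<open>Y\<close>, respectively.\<close>

lemma few_missing_pairs:
  fixes x :: "'a \<Rightarrow> real" and c l m r :: real
  assumes C: "finite C" "C \<noteq> {}" "Y \<subseteq> C" "card Y = y" and F: "F \<subseteq> C \<times> C - Id"
    and energy: "real (card C) * (\<Sum>v\<in>C. (x v)\<^sup>2) - (\<Sum>v\<in>C. x v)\<^sup>2
      + (\<Sum>(u, v)\<in>F. (x u + x v)\<^sup>2) / 2 \<le> c * (\<Sum>v\<in>Y. (x v)\<^sup>2)"
    and c: "0 \<le> c" and nz: "\<exists>v\<in>C. x v \<noteq> 0"
    and pos: "0 < l" "0 < r" "0 \<le> m"
    and l: "l * m + c * y * (1 + r) < 4 * m" and s: "c + 8 * m / l + c / r < card C"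
  shows "card F < 2 * m"
proof (rule ccontr)
  assume "\<not> ?thesis"
  then have mF: "m \<le> card F / 2" by simp
  define s where "s = real (card C)"
  have s0: "0 < s" using C by (simp add: s_def card_gt_0_iff)
  define a where "a = (\<Sum>v\<in>C. x v) / s"
  define e where "e v = x v - a" for v
  define S where "S = (\<Sum>v\<in>C. (e v)\<^sup>2)"
  have e0: "(\<Sum>v\<in>C. e v) = 0"
    using s0 by (simp add: e_def sum_subtractf a_def s_def)
  have S0: "0 \<le> S" by (simp add: S_def sum_nonneg)
  have x: "x v = a + e v" for v by (simp add: e_def)
  have sx: "(\<Sum>v\<in>C. (x v)\<^sup>2) = s * a\<^sup>2 + S"
  proof -
    have "(\<Sum>v\<in>C. (x v)\<^sup>2) = s * a\<^sup>2 + S + 2 * a * (\<Sum>v\<in>C. e v)"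
      unfolding x power2_sum sum.distrib by (simp add: S_def s_def sum_distrib_left)
    then show ?thesis using e0 by simp
  qed
  have var: "s * (\<Sum>v\<in>C. (x v)\<^sup>2) - (\<Sum>v\<in>C. x v)\<^sup>2 = s * S"
  proof -
    have "(\<Sum>v\<in>C. x v) = s * a" using s0 by (simp add: a_def)
    then show ?thesis using sx by (simp add: power2_eq_square algebra_simps)
  qed
  \<comment> \<open>A common lower bound for the squares over \<open>F\<close>: completing the
    square trades \<open>4 * a * (e u + e v)\<close> for \<open>l * a^2\<close> and
    \<open>4 / l * (e u + e v)^2\<close>, and the latter square is at most
    \<open>2 * S\<close>.\<close>
  define R where "R = (4 - l) * a\<^sup>2 - 8 * S / l"
  have fF: "finite F" using C(1) F finite_subset by blast
  have pair: "R \<le> (x u + x v)\<^sup>2" if "(u, v) \<in> F" for u v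
  proof -
    have uv: "u \<in> C" "v \<in> C" "u \<noteq> v" using that F by auto
    have "(e u)\<^sup>2 + (e v)\<^sup>2 = (\<Sum>w\<in>{u, v}. (e w)\<^sup>2)" using uv(3) by simp
    also have "\<dots> \<le> S" unfolding S_def using C(1) uv by (intro sum_mono2) auto
    finally have "(e u + e v)\<^sup>2 \<le> 2 * S" using weighted_power2_add_le[of 1 "e u" "e v"] by simp
    then have "4 / l * (e u + e v)\<^sup>2 \<le> 4 / l * (2 * S)" using pos(1) by (intro mult_left_mono) auto
    moreover have "0 \<le> (l * a + 2 * (e u + e v))\<^sup>2 / l" using pos(1) by simp
    moreover have "(l * a + 2 * (e u + e v))\<^sup>2 / l
        = l * a\<^sup>2 + 4 * a * (e u + e v) + 4 / l * (e u + e v)\<^sup>2"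
      using pos(1) by (simp add: power2_eq_square field_simps)
    moreover have "(x u + x v)\<^sup>2 = 4 * a\<^sup>2 + 4 * a * (e u + e v) + (e u + e v)\<^sup>2"
      unfolding x by (simp add: power2_eq_square algebra_simps)
    moreover have "0 \<le> (e u + e v)\<^sup>2" by simp
    moreover have "R = 4 * a\<^sup>2 - l * a\<^sup>2 - 4 / l * (2 * S)" by (simp add: R_def algebra_simps)
    ultimately show ?thesis by linarith
  qed
  \<comment> \<open>The number of pairs is only bounded from below, so passing from
    \<open>card F / 2\<close> to \<open>m\<close> needs \<open>R \<ge> 0\<close>; for negative
    \<open>R\<close> the claim is trivial.\<close>
  have "m * R \<le> (\<Sum>(u, v)\<in>F. (x u + x v)\<^sup>2) / 2"
  proof (cases "0 \<le> R")
    case True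
    have "card F * R \<le> (\<Sum>(u, v)\<in>F. (x u + x v)\<^sup>2)"
      using sum_bounded_below[of F R "\<lambda>(u, v). (x u + x v)\<^sup>2"] pair by fastforce
    then show ?thesis using mult_right_mono[OF mF True] by simp
  next
    case False
    then have "m * R \<le> 0" using pos(3) by (simp add: mult_nonneg_nonpos)
    also have "0 \<le> (\<Sum>(u, v)\<in>F. (x u + x v)\<^sup>2) / 2" by (simp add: sum_nonneg split_def)
    finally show ?thesis .
  qed
  moreover have "(\<Sum>v\<in>Y. (x v)\<^sup>2) \<le> y * (1 + r) * a\<^sup>2 + (1 + 1 / r) * S"
  proof -
    have "(\<Sum>v\<in>Y. (x v)\<^sup>2) \<le> (\<Sum>v\<in>Y. (1 + r) * a\<^sup>2 + (1 + 1 / r) * (e v)\<^sup>2)"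
      unfolding x using weighted_power2_add_le[OF pos(2)] by (intro sum_mono)
    also have "\<dots> = y * (1 + r) * a\<^sup>2 + (1 + 1 / r) * (\<Sum>v\<in>Y. (e v)\<^sup>2)"
      using C(4) by (simp add: sum.distrib sum_distrib_left)
    also have "(\<Sum>v\<in>Y. (e v)\<^sup>2) \<le> S" unfolding S_def using C by (intro sum_mono2) auto
    finally show ?thesis using pos(2) by (simp add: mult_left_mono)
  qed
  then have "c * (\<Sum>v\<in>Y. (x v)\<^sup>2) \<le> c * (y * (1 + r) * a\<^sup>2 + (1 + 1 / r) * S)"
    using c by (rule mult_left_mono)
  ultimately have "s * S + m * R \<le> c * (y * (1 + r) * a\<^sup>2 + (1 + 1 / r) * S)"
    using energy var by (simp add: s_def)
  \<comment> \<open>The hypotheses \<open>l\<close> and \<open>s\<close> say exactly that both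
    brackets are positive, so \<open>a\<close> and \<open>S\<close> vanish and \<open>x\<close> is
    zero on \<open>C\<close>.\<close>
  then have le: "(4 * m - l * m - c * y * (1 + r)) * a\<^sup>2 + (s - c - 8 * m / l - c / r) * S \<le> 0"
    by (simp add: R_def algebra_simps)
  have "a = 0 \<and> S = 0"
  proof -
    have A: "0 < 4 * m - l * m - c * y * (1 + r)" and B: "0 < s - c - 8 * m / l - c / r"
      using l s by (simp_all add: s_def)
    have "0 \<le> (4 * m - l * m - c * y * (1 + r)) * a\<^sup>2" "0 \<le> (s - c - 8 * m / l - c / r) * S"
      using A B S0 by simp_all
    then have "(4 * m - l * m - c * y * (1 + r)) * a\<^sup>2 = 0" "(s - c - 8 * m / l - c / r) * S = 0"
      using le by linarith+
    then show ?thesis using A B by simp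
  qed
  then have "(\<Sum>v\<in>C. (x v)\<^sup>2) = 0" using sx by simp
  then show False using nz C(1) by (simp add: sum_nonneg_eq_0_iff)
qed

text \<open>The energy bound supplies \<open>c = k * (1 + y / p)\<close>. The weights
  \<open>p\<close>, \<open>l\<close> and \<open>t\<close> stay free, because the two families leave
  gaps of different size.\<close>

lemma exceptional_few_missing:
  fixes l m p q t :: real
  assumes G: "sgraph V E" and ev: "signless_eigenvector V E q x"
    and X: "X \<subset> V" "card X = k" and Y: "Y \<subseteq> V - X" "card Y = y" "0 < y"
    and nb: "\<And>u. u \<in> X \<Longrightarrow> E `` {u} - X = Y" and r: "\<And>u. u \<in> X \<Longrightarrow> card (E `` {u} \<inter> X) = r"
    and q: "2 * (real (card (V - X)) - 1) \<le> q" "p + y + 2 * real r + 1 \<le> q" and p: "0 < p"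
    and pos: "0 < l" "0 < t" "0 \<le> m"
    and l: "l * m + k * (1 + y / p) * y * (1 + t) < 4 * m"
    and s: "k * (1 + y / p) + 8 * m / l + k * (1 + y / p) / t < card (V - X)"
  shows "card ((V - X) \<times> (V - X) - Id - E) < 2 * m"
proof (rule few_missing_pairs[where Y = Y and y = y, OF _ _ Y(1,2) _ _ _ _ pos l s])
  let ?C = "V - X"
  have fC: "finite ?C" and fX: "finite X" using sgraphD(1)[OF G] X(1) finite_subset by auto
  then show "finite ?C" by simp
  have en: "real (card ?C) * (\<Sum>v\<in>?C. (x v)\<^sup>2) - (\<Sum>v\<in>?C. x v)\<^sup>2
      + (\<Sum>(u, v)\<in>?C \<times> ?C - Id - E. (x u + x v)\<^sup>2) / 2 + (\<Sum>v\<in>X. (x v)\<^sup>2)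
    \<le> k * (1 + y / p) * (\<Sum>v\<in>Y. (x v)\<^sup>2)"
    using exceptional_energy[OF G ev _ X(2) Y nb r q p] X(1) by blast
  have "0 \<le> (\<Sum>v\<in>X. (x v)\<^sup>2)" by (simp add: sum_nonneg)
  then show "real (card ?C) * (\<Sum>v\<in>?C. (x v)\<^sup>2) - (\<Sum>v\<in>?C. x v)\<^sup>2
      + (\<Sum>(u, v)\<in>?C \<times> ?C - Id - E. (x u + x v)\<^sup>2) / 2 \<le> k * (1 + y / p) * (\<Sum>v\<in>Y. (x v)\<^sup>2)"
    using en by linarith
  \<comment> \<open>If \<open>x\<close> vanished on \<open>C\<close>, the copy of the square sum
    over \<open>X\<close> kept in the energy bound would be at most 0, and \<open>x\<close> would
    vanish everywhere.\<close>
  show "\<exists>v\<in>?C. x v \<noteq> 0"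
  proof (rule ccontr)
    assume "\<not> ?thesis"
    then have z: "x v = 0" if "v \<in> ?C" for v using that by blast
    then have "(\<Sum>v\<in>Y. (x v)\<^sup>2) = 0" using Y(1) by (intro sum.neutral) auto
    moreover have "(\<Sum>(u, v)\<in>?C \<times> ?C - Id - E. (x u + x v)\<^sup>2) = 0"
      using z by (intro sum.neutral) auto
    ultimately have "(\<Sum>v\<in>X. (x v)\<^sup>2) \<le> 0" using en z by simp
    then have "(\<Sum>v\<in>X. (x v)\<^sup>2) = 0" by (simp add: sum_nonneg order_antisym)
    then have "x v = 0" if "v \<in> X" for v using that fX by (simp add: sum_nonneg_eq_0_iff)
    then show False using z ev by (auto simp: signless_eigenvector_def)
  qed
qed (use X p in auto)

section \<open>Choice of the weights for the two families\<close>

lemma M_few_missing: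
  assumes G: "sgraph V E" and n: "card V = n" and ev: "signless_eigenvector V E q x"
    and k: "2 \<le> k" "k ^ 4 + k ^ 3 + 4 * k ^ 2 + k + 6 \<le> n"
    and X: "X \<subseteq> V" "card X = k" and Y: "Y \<subseteq> V - X" "card Y = k"
    and nb: "\<And>u. u \<in> X \<Longrightarrow> E `` {u} = Y"
    and q: "2 * (real n - real k - 1) \<le> q"
  shows "card ((V - X) \<times> (V - X) - Id - E) < 2 * (k\<^sup>2 div 4 + 1)"
proof -
  define K where "K = real k"
  \<comment> \<open>The largest value with \<open>p + y + 2 * r + 1 \<le> 2 * (n - k - 1)\<close>
    for \<open>y = k\<close> and \<open>r = 0\<close>.\<close>
  define p where "p = 2 * real n - 3 * K - 3"
  define d where "d = k\<^sup>2 div 4 + 1"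
  define m where "m = real d"
  have "real (k ^ 4 + k ^ 3 + 4 * k ^ 2 + k + 6) \<le> real n" using k(2) of_nat_le_iff by blast
  then have nK: "K ^ 4 + K ^ 3 + 4 * K\<^sup>2 + K + 6 \<le> real n" by (simp add: K_def)
  have K2: "2 \<le> K" using k by (simp add: K_def)
  have K22: "4 \<le> K\<^sup>2" using power_mono[OF K2, of 2] by simp
  \<comment> \<open>Squares are 0 or 1 modulo 4. This widens the gap from
    \<open>4 * m \<ge> K^2 + 1\<close> to \<open>4 * m \<ge> K^2 + 3\<close>.\<close>
  have "k\<^sup>2 mod 4 \<le> 1"
  proof (cases "even k")
    case True
    then show ?thesis by (auto elim!: evenE simp: power2_eq_square)
  next
    case False
    then obtain j where "k = 2 * j + 1" by (auto elim: oddE)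
    then have "k\<^sup>2 = 1 + 4 * (j\<^sup>2 + j)" by (simp add: power2_eq_square)
    then show ?thesis by presburger
  qed
  then have "k\<^sup>2 + 3 \<le> 4 * d" "4 * d \<le> k\<^sup>2 + 4" unfolding d_def by presburger+
  then have "real (k\<^sup>2 + 3) \<le> real (4 * d)" "real (4 * d) \<le> real (k\<^sup>2 + 4)" using of_nat_le_iff by blast+
  then have m: "K\<^sup>2 + 3 \<le> 4 * m" "4 * m \<le> K\<^sup>2 + 4" by (simp_all add: K_def m_def)
  have m0: "0 < m" using m(1) K22 by linarith
  have p10: "10 * K ^ 3 \<le> p"
  proof -
    have "0 \<le> 2 * K\<^sup>2 * (K - 2)\<^sup>2 + (9 - K)"
    proof (cases "k = 2")
      case False
      then have "3 \<le> k" using k(1) by linarith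
      then have "1 \<le> K - 2" by (simp add: K_def)
      then have "2 * K\<^sup>2 * 1 \<le> 2 * K\<^sup>2 * (K - 2)\<^sup>2" by (intro mult_left_mono) auto
      moreover have "K \<le> K\<^sup>2" using K2 by (simp add: power2_eq_square)
      ultimately show ?thesis using K22 by linarith
    qed (simp add: K_def)
    also have "\<dots> = 2 * (K ^ 4 + K ^ 3 + 4 * K\<^sup>2 + K + 6) - 3 * K - 3 - 10 * K ^ 3"
      by (simp add: power2_eq_square power3_eq_cube power4_eq_xxxx algebra_simps)
    finally show ?thesis using nK by (simp add: p_def)
  qed
  have K30: "0 < K ^ 3" using K2 by simp
  then have p0: "0 < p" using p10 by linarith
  define c where "c = K * (1 + K / p)"
  have cK: "c * K \<le> K\<^sup>2 + 1 / 10"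
  proof -
    have "c * K = K\<^sup>2 + K ^ 3 / p" by (simp add: c_def power2_eq_square power3_eq_cube algebra_simps)
    moreover have "K ^ 3 / p \<le> 1 / 10" using p10 p0 by (simp add: field_simps)
    ultimately show ?thesis by linarith
  qed
  have cK2: "c * K\<^sup>2 \<le> K ^ 3 + K / 10"
    using mult_right_mono[OF cK, of K] K2 by (simp add: power2_eq_square power3_eq_cube algebra_simps)
  have c1: "c \<le> K + 1 / 10"
  proof -
    have "c * K \<le> (K + 1 / 10) * K" using cK K2 by (simp add: power2_eq_square algebra_simps)
    then show ?thesis using K2 by simp
  qed
  \<comment> \<open>The gap of 3 is spent as follows: \<open>3/2\<close> on \<open>l * m\<close>, 1
    on \<open>t = 1 / K^2\<close>, and \<open>1/10 + 1/40\<close> on the error from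
    \<open>p\<close>.\<close>
  have lm: "3 / (2 * m) * m + k * (1 + k / p) * k * (1 + 1 / K\<^sup>2) < 4 * m"
  proof -
    have "c * K * (1 + 1 / K\<^sup>2) \<le> (K\<^sup>2 + 1 / 10) * (1 + 1 / K\<^sup>2)"
      by (rule mult_right_mono[OF cK]) simp
    also have "\<dots> = K\<^sup>2 + 1 + 1 / 10 + 1 / 10 * (1 / K\<^sup>2)" using K2 by (simp add: field_simps)
    also have "\<dots> \<le> K\<^sup>2 + 1 + 1 / 10 + 1 / 10 * (1 / 4)"
      using K22 by (intro add_left_mono mult_left_mono divide_left_mono) auto
    finally show ?thesis using m(1) m0 by (simp add: K_def[symmetric] c_def)
  qed
  \<comment> \<open>Here \<open>c / t\<close> is about \<open>K^3\<close>, which the cubic term of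
    the bound on \<open>n\<close> pays for, and \<open>8 * m / l = (4 * m)^2 / 3\<close> is about
    \<open>K^4 / 3\<close>.\<close>
  have sm: "k * (1 + k / p) + 8 * m / (3 / (2 * m)) + k * (1 + k / p) / (1 / K\<^sup>2) < real n - k"
  proof -
    have "(4 * m)\<^sup>2 \<le> (K\<^sup>2 + 4)\<^sup>2" using m m0 by (intro power_mono) auto
    also have "\<dots> = K ^ 4 + 8 * K\<^sup>2 + 16" by (simp add: power2_eq_square power4_eq_xxxx algebra_simps)
    finally have "8 * m / (3 / (2 * m)) \<le> K ^ 4 / 3 + 8 / 3 * K\<^sup>2 + 16 / 3"
      by (simp add: power2_eq_square)
    moreover have "K \<le> K\<^sup>2" "0 \<le> K ^ 4" using K2 by (simp_all add: power2_eq_square)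
    ultimately have "c + 8 * m / (3 / (2 * m)) + c * K\<^sup>2 < real n - K"
      using c1 cK2 nK K2 K22 by linarith
    then show ?thesis by (simp add: K_def[symmetric] c_def)
  qed
  have "k < n" using k(2) by linarith
  then have c: "real (card (V - X)) = real n - k" and XV: "X \<noteq> V"
    using X n sgraphD(1)[OF G] by (auto simp: card_Diff_subset finite_subset of_nat_diff)
  have nb1: "E `` {u} - X = Y" and nb2: "card (E `` {u} \<inter> X) = 0" if "u \<in> X" for u
    using nb[OF that] Y(1) by (auto simp: card_eq_0_iff)
  have "real (card ((V - X) \<times> (V - X) - Id - E)) < 2 * m"
  proof (rule exceptional_few_missing[OF G ev _ X(2) Y _ nb1 nb2, where p = p
      and l = "3 / (2 * m)" and t = "1 / K\<^sup>2"])
    show "X \<subset> V" using X(1) XV by blast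
    show "2 * (real (card (V - X)) - 1) \<le> q" using q c by simp
    show "p + real k + 2 * real 0 + 1 \<le> q" using q k(1) by (simp add: p_def K_def)
  qed (use k(1) K2 m0 p0 c lm sm in simp_all)
  then show ?thesis by (simp add: m_def d_def)
qed

lemma L_few_missing:
  assumes G: "sgraph V E" and n: "card V = n" and ev: "signless_eigenvector V E q x"
    and k: "2 \<le> k" "k ^ 4 + k ^ 3 + 4 * k ^ 2 + k + 6 \<le> n"
    and X: "X \<subseteq> V" "card X = k" and Y: "Y \<subseteq> V - X" "card Y = 1"
    and nb: "\<And>u. u \<in> X \<Longrightarrow> E `` {u} = Y \<union> (X - {u})"
    and q: "2 * (real n - real k - 1) \<le> q"
  shows "card ((V - X) \<times> (V - X) - Id - E) < 2 * (k div 4 + 1)"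
proof -
  define K where "K = real k"
  \<comment> \<open>Again the largest admissible value, now for \<open>y = 1\<close> and
    \<open>r = k - 1\<close>.\<close>
  define p where "p = 2 * real n - 4 * K - 2"
  define d where "d = k div 4 + 1"
  define m where "m = real d"
  have "real (k ^ 4 + k ^ 3 + 4 * k ^ 2 + k + 6) \<le> real n" using k(2) of_nat_le_iff by blast
  then have nK: "K ^ 4 + K ^ 3 + 4 * K\<^sup>2 + K + 6 \<le> real n" by (simp add: K_def)
  have K2: "2 \<le> K" using k by (simp add: K_def)
  have K22: "2 * K \<le> K\<^sup>2" "2 * K\<^sup>2 \<le> K ^ 3" "2 * K ^ 3 \<le> K ^ 4"
    using K2 by (simp_all add: power2_eq_square power3_eq_cube power4_eq_xxxx mult_right_mono)
  have "k + 1 \<le> 4 * d" unfolding d_def by presburger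
  then have "real (k + 1) \<le> real (4 * d)" using of_nat_le_iff by blast
  then have m: "K + 1 \<le> 4 * m" by (simp add: K_def m_def)
  have m0: "0 < m" using m K2 by linarith
  have p10: "10 * K \<le> p" using nK K2 K22 by (simp add: p_def)
  then have p0: "0 < p" using K2 by linarith
  define c where "c = K * (1 + 1 / p)"
  have c1: "c \<le> K + 1 / 10"
  proof -
    have "K / p \<le> 1 / 10" using p10 p0 by (simp add: field_simps)
    then show ?thesis by (simp add: c_def algebra_simps)
  qed
  \<comment> \<open>The gap is only 1: \<open>l * m\<close> takes \<open>1/2\<close>,
    \<open>t = 1 / (4 * K)\<close> takes \<open>1/4\<close>, and the error from \<open>p\<close>
    takes \<open>1/10 + 1/80\<close>.\<close>
  have lm: "1 / (2 * m) * m + k * (1 + 1 / p) * 1 * (1 + 1 / (4 * K)) < 4 * m"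
  proof -
    have "c * (1 + 1 / (4 * K)) \<le> (K + 1 / 10) * (1 + 1 / (4 * K))"
      by (rule mult_right_mono[OF c1]) (use K2 in simp)
    also have "\<dots> = K + 1 / 4 + 1 / 10 + 1 / 40 * (1 / K)" using K2 by (simp add: field_simps)
    also have "\<dots> \<le> K + 1 / 4 + 1 / 10 + 1 / 40 * (1 / 2)"
      using K2 by (intro add_left_mono mult_left_mono divide_left_mono) auto
    finally show ?thesis using m m0 by (simp add: K_def[symmetric] c_def)
  qed
  \<comment> \<open>Now \<open>c / t = 4 * K * c\<close> is about \<open>4 * K^2\<close>, matched by
    the quadratic term of the bound on \<open>n\<close>, and
    \<open>8 * m / l = 16 * m^2\<close>.\<close>
  have sm: "k * (1 + 1 / p) + 8 * m / (1 / (2 * m)) + k * (1 + 1 / p) / (1 / (4 * K)) < real n - k"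
  proof -
    have m16: "16 * m\<^sup>2 + K\<^sup>2 < K ^ 4 + K ^ 3 + 5"
    \<comment> \<open>For \<open>k = 2\<close> the estimate \<open>4 * m \<le> K + 4\<close> is too
      weak, but \<open>m = 1\<close> is explicit.\<close>
    proof (cases "k = 2")
      case True
      then show ?thesis by (simp add: m_def d_def K_def)
    next
      case False
      then have "3 \<le> k" using k(1) by linarith
      then have K3: "3 \<le> K" by (simp add: K_def)
      have "4 * d \<le> k + 4" by (simp add: d_def)
      then have "real (4 * d) \<le> real (k + 4)" using of_nat_le_iff by blast
      then have "4 * m \<le> K + 4" by (simp add: m_def K_def)
      then have "(4 * m)\<^sup>2 \<le> (K + 4)\<^sup>2" using m0 by (intro power_mono) auto
      then have "16 * m\<^sup>2 \<le> K\<^sup>2 + 8 * K + 16" by (simp add: power2_eq_square algebra_simps)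
      moreover have "3 * K \<le> K\<^sup>2" "3 * K\<^sup>2 \<le> K ^ 3" "3 * K ^ 3 \<le> K ^ 4"
        using K3 by (simp_all add: power2_eq_square power3_eq_cube power4_eq_xxxx mult_right_mono)
      ultimately show ?thesis using K3 by linarith
    qed
    have "c * (4 * K) \<le> (K + 1 / 10) * (4 * K)" using c1 K2 by (intro mult_right_mono) auto
    then have "c * (4 * K) \<le> 4 * K\<^sup>2 + 4 / 10 * K" by (simp add: power2_eq_square algebra_simps)
    then have "c + 16 * m\<^sup>2 + c * (4 * K) < real n - K"
      using c1 nK K2 K22 m16 by linarith
    then show ?thesis by (simp add: K_def[symmetric] c_def power2_eq_square mult.assoc)
  qed
  have "k < n" using k(2) by linarith
  then have c: "real (card (V - X)) = real n - k" and XV: "X \<noteq> V"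
    using X n sgraphD(1)[OF G] by (auto simp: card_Diff_subset finite_subset of_nat_diff)
  have nb1: "E `` {u} - X = Y" and nb2: "card (E `` {u} \<inter> X) = k - 1" if "u \<in> X" for u
  proof -
    show "E `` {u} - X = Y" using nb[OF that] Y(1) by auto
    have "E `` {u} \<inter> X = X - {u}" using nb[OF that] Y(1) by auto
    then show "card (E `` {u} \<inter> X) = k - 1" using that X by simp
  qed
  have "real (card ((V - X) \<times> (V - X) - Id - E)) < 2 * m"
  proof (rule exceptional_few_missing[OF G ev _ X(2) Y _ nb1 nb2, where p = p
      and l = "1 / (2 * m)" and t = "1 / (4 * K)"])
    show "X \<subset> V" using X(1) XV by blast
    show "2 * (real (card (V - X)) - 1) \<le> q" using q c by simp
    show "p + real 1 + 2 * real (k - 1) + 1 \<le> q" using q k(1) by (simp add: p_def K_def of_nat_diff)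
  qed (use k(1) K2 m0 p0 c lm sm in simp_all)
  then show ?thesis by (simp add: m_def d_def)
qed

subsection \<open>The largest eigenvalue and the exceptional families\<close>

text \<open>\<open>q_index\<close> is a \<open>Max\<close> over the real spectrum, so this set must
  be shown nonempty. A complex eigenvalue exists; the Hermitian form \<open>z\<close> is its own
  conjugate, so the eigenvalue is real.\<close>

lemma real_symmetric_eigenvalue_exists:
  fixes A :: "real mat"
  assumes A: "A \<in> carrier_mat n n" and n: "n > 0"
    and sym: "\<And>i j. i < n \<Longrightarrow> j < n \<Longrightarrow> A $$ (i, j) = A $$ (j, i)"
  shows "\<exists>c. eigenvalue A c"
proof -
  define B where "B = map_mat complex_of_real A"
  have B: "B \<in> carrier_mat n n" using A by (simp add: B_def)
  obtain c w where w: "w \<in> carrier_vec n" "w \<noteq> 0\<^sub>v n" and ev: "B *\<^sub>v w = c \<cdot>\<^sub>v w"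
    using spectrum_non_empty[OF B n] B
    by (auto simp: spectrum_def eigenvalue_def eigenvector_def)
  have row: "(\<Sum>j<n. complex_of_real (A $$ (i, j)) * w $ j) = c * w $ i" if "i < n" for i
  proof -
    have "(B *\<^sub>v w) $ i = (\<Sum>j<n. complex_of_real (A $$ (i, j)) * w $ j)"
      using that A w by (auto simp: B_def scalar_prod_def atLeast0LessThan intro!: sum.cong)
    then show ?thesis using ev that w by simp
  qed
  define z where "z = (\<Sum>i<n. \<Sum>j<n. cnj (w $ i) * complex_of_real (A $$ (i, j)) * w $ j)"
  define N where "N = (\<Sum>i<n. (cmod (w $ i))\<^sup>2)"
  have "z = (\<Sum>i<n. cnj (w $ i) * (c * w $ i))"
    unfolding z_def by (intro sum.cong refl) (simp add: row[symmetric] sum_distrib_left mult.assoc)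
  also have "\<dots> = c * complex_of_real N"
    by (simp add: N_def sum_distrib_left complex_norm_square mult_ac del: of_real_power)
  finally have z: "z = c * complex_of_real N" .
  have "cnj z = (\<Sum>i<n. \<Sum>j<n. w $ i * complex_of_real (A $$ (i, j)) * cnj (w $ j))"
    by (simp add: z_def)
  also have "\<dots> = (\<Sum>j<n. \<Sum>i<n. w $ i * complex_of_real (A $$ (i, j)) * cnj (w $ j))"
    by (rule sum.swap)
  also have "\<dots> = z"
    unfolding z_def by (intro sum.cong refl) (simp add: sym mult_ac)
  finally have "cnj c * complex_of_real N = c * complex_of_real N" by (simp add: z)
  moreover obtain i where i: "i < n" "w $ i \<noteq> 0" using w by (auto simp: vec_eq_iff)
  then have "0 < N" unfolding N_def by (intro sum_pos2[of _ i]) auto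
  ultimately have "cnj c = c" by simp
  then have c: "c = complex_of_real (Re c)" by (simp add: complex_eq_iff)
  \<comment> \<open>As \<open>A\<close> and \<open>c\<close> are real, the row equations hold
    separately for the real and the imaginary part of \<open>w\<close>, one of which is
    nonzero.\<close>
  have part: "eigenvalue A (Re c)"
    if g: "\<And>i. i < n \<Longrightarrow> (\<Sum>j<n. A $$ (i, j) * g j) = Re c * g i" and "g i \<noteq> 0" for g
  proof -
    have "A *\<^sub>v vec n g = Re c \<cdot>\<^sub>v vec n g"
      using A g by (auto simp: scalar_prod_def atLeast0LessThan intro!: eq_vecI)
    moreover have "vec n g \<noteq> 0\<^sub>v n" using i \<open>g i \<noteq> 0\<close> by (auto simp: vec_eq_iff)
    ultimately show ?thesis using A unfolding eigenvalue_def eigenvector_def by (intro exI[of _ "vec n g"]) auto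
  qed
  have "Re (w $ i) \<noteq> 0 \<or> Im (w $ i) \<noteq> 0" using i by (simp add: complex_eq_iff)
  moreover have "(\<Sum>j<n. A $$ (l, j) * Re (w $ j)) = Re c * Re (w $ l)" if "l < n" for l
    using arg_cong[OF row[OF that], of Re] c by (simp add: complex_eq_iff)
  moreover have "(\<Sum>j<n. A $$ (l, j) * Im (w $ j)) = Re c * Im (w $ l)" if "l < n" for l
    using arg_cong[OF row[OF that], of Im] c by (simp add: complex_eq_iff)
  ultimately show ?thesis
    using part[of "\<lambda>j. Re (w $ j)"] part[of "\<lambda>j. Im (w $ j)"] by blast
qed

lemma eigenvalue_q_index:
  assumes G: "pair_graph G" and ne: "pverts G \<noteq> {}"
  shows "eigenvalue (signless_laplacian G) (q_index G)"
proof -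
  define n where "n = length (vertex_list G)"
  have Q: "signless_laplacian G \<in> carrier_mat n n"
    by (simp add: signless_laplacian_def adjacency_matrix_def degree_matrix_def Let_def n_def)
  have "n > 0" using vertex_list[OF finite_pverts[OF G]] ne by (auto simp: n_def)
  moreover have "signless_laplacian G $$ (i, j) = signless_laplacian G $$ (j, i)"
    if "i < n" "j < n" for i j
    using that pair_graph_arcD(4)[OF G]
    by (auto simp: signless_laplacian_def adjacency_matrix_def degree_matrix_def Let_def n_def)
  ultimately have "spectrum (signless_laplacian G) \<noteq> {}"
    using real_symmetric_eigenvalue_exists[OF Q] by (auto simp: spectrum_def)
  then have "q_index G \<in> spectrum (signless_laplacian G)"
    unfolding q_index_def using card_finite_spectrum(1)[OF Q] by (intro Max_in)
  then show ?thesis by (simp add: spectrum_def)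
qed

lemma sgraph_pair_graph:
  assumes "pair_graph G"
  shows "sgraph (pverts G) (parcs G)"
  unfolding sgraph_def
proof (intro conjI)
  show "sym (parcs G)" "irrefl (parcs G)"
    using pair_graph_arcD(3,4)[OF assms] by (auto intro: symI irreflI)
qed (use pair_graph_arcD(1,2)[OF assms] finite_pverts[OF assms] in auto)

lemma out_degree_eq_deg: "out_degree (with_proj G) v = deg (parcs G) v"
  by (simp add: out_degree_with_proj Image_singleton)

lemma signless_eigenvector_q_index:
  assumes "pair_graph G" "pverts G \<noteq> {}"
  shows "\<exists>x. signless_eigenvector (pverts G) (parcs G) (q_index G) x"
  using eigenvalue_q_index[OF assms] unfolding eigenvalue_signless_laplacian_iff[OF assms(1)]
  by (simp add: signless_eigenvector_def out_degree_eq_deg Image_singleton)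

section \<open>Passage to the walks and the connectivity of \<open>pair_graph\<close>\<close>

lemma closed_awalk_of_vertices:
  assumes "xs \<noteq> []" "successively (\<lambda>u v. (u, v) \<in> parcs G) xs" "(last xs, w) \<in> parcs G"
  shows "pre_digraph.cas (with_proj G) (hd xs) (zip xs (tl xs @ [w])) w
    \<and> set (zip xs (tl xs @ [w])) \<subseteq> parcs G
    \<and> pre_digraph.awalk_verts (with_proj G) (hd xs) (zip xs (tl xs @ [w])) = xs @ [w]"
  using assms
\<comment> \<open>The end \<open>w\<close> is kept apart from \<open>hd xs\<close>: the induction
  strips the head, which is the vertex to which the cycle finally returns.\<close>
proof (induction xs)
  case (Cons x xs)
  show ?case
  proof (cases xs)
    case Nil
    then show ?thesis
      using Cons.prems by (simp add: pre_digraph.cas.simps pre_digraph.awalk_verts.simps)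
  next
    case (Cons y ys)
    then show ?thesis
      using Cons.IH Cons.prems by (simp add: pre_digraph.cas.simps pre_digraph.awalk_verts.simps)
  qed
qed simp

lemma has_hamiltonian_cycle_if_hamiltonian:
  assumes G: "pair_graph G" and "hamiltonian (pverts G) (parcs G)"
  shows "has_hamiltonian_cycle G"
proof -
  obtain xs where xs: "distinct xs" "set xs = pverts G" "3 \<le> length xs"
    "successively (\<lambda>u v. (u, v) \<in> parcs G) xs" "(last xs, hd xs) \<in> parcs G"
    using assms(2) by (auto simp: hamiltonian_def)
  have ne: "xs \<noteq> []" using xs(3) by auto
  define p where "p = zip xs (tl xs @ [hd xs])"
  have p: "pre_digraph.cas (with_proj G) (hd xs) p (hd xs)" "set p \<subseteq> parcs G"
    "pre_digraph.awalk_verts (with_proj G) (hd xs) p = xs @ [hd xs]"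
    using closed_awalk_of_vertices[OF ne xs(4,5)] by (simp_all add: p_def)
  have len: "length xs = length (tl xs @ [hd xs])" using ne by simp
  have "pre_digraph.awalk (with_proj G) (hd xs) p (hd xs)"
    using p xs(2) ne by (auto simp: pre_digraph.awalk_def)
  moreover have "distinct (tl (xs @ [hd xs]))" using xs(1) ne by (cases xs) auto
  moreover have "p \<noteq> []" using ne by (cases xs) (auto simp: p_def)
  ultimately have "pre_digraph.cycle (with_proj G) p"
    unfolding pre_digraph.cycle_def using p(3) by (intro exI[of _ "hd xs"]) simp
  moreover have fst: "map fst p = xs" unfolding p_def by (rule map_fst_zip[OF len])
  have "fst ` set p = set (map fst p)" by simp
  then have "fst ` set p = pverts G" unfolding fst xs(2) .
  moreover have "length p = length (map fst p)" by simp
  then have "3 \<le> length p" unfolding fst using xs(3) by simp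
  ultimately show ?thesis unfolding has_hamiltonian_cycle_def by blast
qed

lemma connected_crossing_arc:
  assumes G: "pair_graph G" and conn: "Digraph_Component.connected (with_proj G)"
    and S: "S \<subset> pverts G" "S \<noteq> {}"
  shows "\<exists>u\<in>S. \<exists>v\<in>pverts G - S. (u, v) \<in> parcs G"
proof (rule ccontr)
  assume none: "\<not> ?thesis"
  obtain u v where u: "u \<in> S" and v: "v \<in> pverts G" "v \<notin> S" using S by auto
  have sc: "strongly_connected (with_proj (mk_symmetric (with_proj G)))"
    using conn by (simp only: connected_def)
  have "u \<in> pverts G" using u S(1) by blast
  then have "u \<in> verts (with_proj (mk_symmetric (with_proj G)))"
    "v \<in> verts (with_proj (mk_symmetric (with_proj G)))"
    using v(1) by (simp_all add: mk_symmetric_def)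
  then have "u \<rightarrow>\<^sup>*\<^bsub>with_proj (mk_symmetric (with_proj G))\<^esub> v"
    by (rule sc[unfolded strongly_connected_def, THEN conjunct2, rule_format])
  then have "(u, v) \<in> (arcs_ends (with_proj (mk_symmetric (with_proj G))))\<^sup>*"
    by (rule reachable_rtranclI)
  \<comment> \<open>Connectivity is strong connectivity of the symmetric closure, and
    \<open>parcs G\<close> is already symmetric.\<close>
  moreover have "arcs_ends (with_proj (mk_symmetric (with_proj G))) = parcs G"
  proof -
    have "arcs_ends (with_proj (mk_symmetric (with_proj G))) = parcs G \<union> {(a, b). (b, a) \<in> parcs G}"
      by (auto simp: mk_symmetric_def arcs_ends_conv)
    then show ?thesis using pair_graph_arcD(4)[OF G] by blast
  qed
  ultimately have "(u, v) \<in> (parcs G)\<^sup>*" by simp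
  then have "v \<in> S"
  proof (induction rule: rtrancl_induct)
    case (step w z)
    have "z \<in> pverts G" using pair_graph_arcD(2)[OF G step.hyps(2)] .
    then show ?case using none step by blast
  qed (rule u)
  then show False using v by simp
qed

section \<open>Missing pairs as deleted edges, and the isomorphism with a family member\<close>

lemma card_unordered_pairs:
  assumes "finite F" "sym F" "irrefl F" "inj_on f (Field F)"
  shows "2 * card ((\<lambda>(u, v). {f u, f v}) ` F) \<le> card F"
proof -
  let ?h = "\<lambda>(u, v). {f u, f v}"
  have "2 \<le> card {a \<in> F. ?h a = e}" if e: "e \<in> ?h ` F" for e
  proof -
    obtain u v where uv: "(u, v) \<in> F" "e = {f u, f v}" using e by auto
    then have "{(u, v), (v, u)} \<subseteq> {a \<in> F. ?h a = e}" using assms(2) by (auto dest: symD)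
    then have "card {(u, v), (v, u)} \<le> card {a \<in> F. ?h a = e}" using assms(1) by (intro card_mono) auto
    moreover have "u \<noteq> v" using uv(1) assms(3) by (auto simp: irrefl_def)
    ultimately show ?thesis by simp
  qed
  then have "(\<Sum>e\<in>?h ` F. 2) \<le> (\<Sum>e\<in>?h ` F. card {a \<in> F. ?h a = e})" by (rule sum_mono)
  also have "\<dots> = card F" using sum.image_gen[OF assms(1), of "\<lambda>_. 1::nat" ?h] by simp
  finally show ?thesis by simp
qed

text \<open>Both exceptional graphs are the join of \<open>K_y\<close> with the disjoint union of
  \<open>K_z\<close> and \<open>P\<close>, where \<open>P\<close> is edgeless or complete on
  \<open>k\<close> vertices. \<open>Y\<close>, the rest \<open>Z\<close> of the clique side and
  \<open>X\<close> are sent to the three parts, and the pairs that \<open>G\<close> lacks outside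
  \<open>X\<close> become the deleted edges.\<close>

lemma iso_join_delete_edges:
  fixes P :: "nat pair_pre_digraph"
  assumes G: "pair_graph G" and X: "X \<subseteq> pverts G" and Y: "Y \<subseteq> pverts G - X" "card Y = y"
    and nb: "\<And>u. u \<in> X \<Longrightarrow> parcs G `` {u} - X = Y"
    and g: "bij_betw g X (pverts P)" and P: "pair_graph P"
    and gP: "\<And>u v. u \<in> X \<Longrightarrow> v \<in> X \<Longrightarrow> (g u, g v) \<in> parcs P \<longleftrightarrow> (u, v) \<in> parcs G"
    and z: "card (pverts G) - card X - y = z"
    and F: "card ((pverts G - X) \<times> (pverts G - X) - Id - parcs G) < 2 * (b + 1)"
  defines "B \<equiv> join (complete_graph y) (disjoint_union (complete_graph z) P)"
  shows "\<exists>E'. E' \<subseteq> {e \<in> edges B. e \<subseteq> Inl ` pverts (complete_graph y)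
        \<union> (Inr \<circ> Inl) ` pverts (complete_graph z)}
    \<and> card E' \<le> b \<and> digraph_iso (with_proj G) (with_proj (delete_edges B E'))"
proof -
  define V where "V = pverts G"
  define E where "E = parcs G"
  define Z where "Z = V - X - Y"
  define D where "D = (V - X) \<times> (V - X) - Id - E"
  have S: "sgraph V E" using sgraph_pair_graph[OF G] by (simp add: V_def E_def)
  note fV = sgraphD(1)[OF S]
  have fin: "finite X" "finite Y" "finite Z" using fV X Y(1) by (auto simp: V_def Z_def intro: finite_subset)
  obtain gY where gY: "bij_betw gY Y {..<y}"
    using finite_same_card_bij[OF fin(2), of "{..<y}"] Y(2) by auto
  have "card Z = z"
    using fin X Y z by (simp add: Z_def V_def card_Diff_subset Diff_Diff_Int)
  then obtain gZ where gZ: "bij_betw gZ Z {..<z}"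
    using finite_same_card_bij[OF fin(3), of "{..<z}"] by auto
  define f where "f v = (if v \<in> Y then Inl (gY v) else if v \<in> Z then Inr (Inl (gZ v)) else Inr (Inr (g v)))" for v
  have disj: "X \<inter> Y = {}" "X \<inter> Z = {}" "Y \<inter> Z = {}" "V = Y \<union> (Z \<union> X)"
    using X Y(1) by (auto simp: V_def Z_def)
  have fY: "f v = Inl (gY v)" if "v \<in> Y" for v using that by (simp add: f_def)
  have fZ: "f v = Inr (Inl (gZ v))" if "v \<in> Z" for v using that disj by (auto simp: f_def)
  have fX: "f v = Inr (Inr (g v))" if "v \<in> X" for v using that disj by (auto simp: f_def)
  have BV: "pverts B = Inl ` {..<y} \<union> ((Inr \<circ> Inl) ` {..<z} \<union> (Inr \<circ> Inr) ` pverts P)"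
    by (auto simp: B_def join_def disjoint_union_def complete_graph_def)
  have bij: "bij_betw f V (pverts B)"
    unfolding disj(4) BV
  proof (intro bij_betw_combine)
    show "bij_betw f Y (Inl ` {..<y})"
      using gY by (auto simp: bij_betw_def inj_on_def fY image_image cong: image_cong)
    show "bij_betw f Z ((Inr \<circ> Inl) ` {..<z})"
      using gZ by (auto simp: bij_betw_def inj_on_def fZ image_image cong: image_cong)
    show "bij_betw f X ((Inr \<circ> Inr) ` pverts P)"
      using g by (auto simp: bij_betw_def inj_on_def fX image_image cong: image_cong)
  qed auto
  then have inj: "inj_on f V" by (simp add: bij_betw_def)
  have nbE: "(u, v) \<in> E \<longleftrightarrow> v \<in> Y" "(v, u) \<in> E \<longleftrightarrow> v \<in> Y" if "u \<in> X" "v \<notin> X" for u v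
    using nb[OF that(1)] that sgraphD(6)[OF S] unfolding E_def by blast+
  have gYeq: "gY u = gY v \<longleftrightarrow> u = v" "gY u < y" if "u \<in> Y" "v \<in> Y" for u v
    using gY that by (auto simp: bij_betw_def inj_on_def)
  have gZeq: "gZ u = gZ v \<longleftrightarrow> u = v" "gZ u < z" if "u \<in> Z" "v \<in> Z" for u v
    using gZ that by (auto simp: bij_betw_def inj_on_def)
  have gV: "g u \<in> pverts P" if "u \<in> X" for u using g that by (auto simp: bij_betw_def)
  have B_simps: "(Inl a, Inl b) \<in> parcs B \<longleftrightarrow> a < y \<and> b < y \<and> a \<noteq> b"
    "(Inl a, Inr (Inl b)) \<in> parcs B \<longleftrightarrow> a < y \<and> b < z"
    "(Inr (Inl b), Inl a) \<in> parcs B \<longleftrightarrow> a < y \<and> b < z"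
    "(Inl a, Inr (Inr b)) \<in> parcs B \<longleftrightarrow> a < y \<and> b \<in> pverts P"
    "(Inr (Inr b), Inl a) \<in> parcs B \<longleftrightarrow> a < y \<and> b \<in> pverts P"
    "(Inr (Inl a), Inr (Inl b)) \<in> parcs B \<longleftrightarrow> a < z \<and> b < z \<and> a \<noteq> b"
    "(Inr (Inl a), Inr (Inr b)) \<notin> parcs B" "(Inr (Inr b), Inr (Inl a)) \<notin> parcs B"
    "(Inr (Inr a), Inr (Inr b)) \<in> parcs B \<longleftrightarrow> (a, b) \<in> parcs P" for a b
    by (auto simp: B_def join_def disjoint_union_def complete_graph_def)
  have XY: "u \<noteq> v \<and> (u, v) \<in> E \<and> (v, u) \<in> E" if "u \<in> X" "v \<in> Y" for u v
    using nbE[OF that(1), of v] that disj(1) by blast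
  have XZ: "(u, v) \<notin> E \<and> (v, u) \<notin> E" if "u \<in> X" "v \<in> Z" for u v
    using nbE[OF that(1), of v] that disj(2,3) by blast
  have nX: "u \<in> Y \<Longrightarrow> u \<notin> X" "u \<in> Z \<Longrightarrow> u \<notin> X" for u using disj(1,2) by blast+
  \<comment> \<open>\<open>B\<close> copies \<open>G\<close> on the arcs meeting \<open>X\<close>
    and fills in all other pairs, so the two differ precisely in \<open>D\<close>.\<close>
  have arcB: "(f u, f v) \<in> parcs B \<longleftrightarrow> u \<noteq> v \<and> ((u \<in> X \<or> v \<in> X) \<longrightarrow> (u, v) \<in> E)"
    if uv: "u \<in> V" "v \<in> V" for u v
  proof -
    have YZ: "w \<noteq> w'" "w' \<noteq> w" if "w \<in> Y" "w' \<in> Z" for w w' using that disj(3) by auto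
    have ne: "(u, v) \<in> E \<Longrightarrow> u \<noteq> v" using sgraphD(7)[OF S] by blast
    consider "u \<in> X" "v \<in> X" | "u \<in> X" "v \<in> Y" | "u \<in> X" "v \<in> Z"
      | "u \<in> Y" "v \<in> X" | "u \<in> Y" "v \<in> Y" | "u \<in> Y" "v \<in> Z"
      | "u \<in> Z" "v \<in> X" | "u \<in> Z" "v \<in> Y" | "u \<in> Z" "v \<in> Z"
      using uv unfolding disj(4) by blast
    then show ?thesis
    proof cases
      case 1
      then show ?thesis using gP[OF 1] ne by (auto simp: fX B_simps E_def)
    next
      case 2
      then show ?thesis using gV[OF 2(1)] gYeq(2)[OF 2(2,2)] XY[OF 2] by (simp add: fX fY B_simps)
    next
      case 3
      then show ?thesis using XZ[OF 3] by (simp add: fX fZ B_simps)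
    next
      case 4
      then show ?thesis
        using gV[OF 4(2)] gYeq(2)[OF 4(1,1)] XY[OF 4(2,1)] by (auto simp: fX fY B_simps)
    next
      case 5
      then show ?thesis using gYeq[of u v] gYeq(2)[of v v] by (simp add: fY B_simps nX)
    next
      case 6
      then show ?thesis using gYeq(2)[of u u] gZeq(2)[of v v] by (simp add: fY fZ B_simps nX YZ)
    next
      case 7
      then show ?thesis using XZ[OF 7(2,1)] by (simp add: fX fZ B_simps)
    next
      case 8
      then show ?thesis using gYeq(2)[of v v] gZeq(2)[of u u] by (simp add: fY fZ B_simps nX YZ)
    next
      case 9
      then show ?thesis using gZeq[of u v] gZeq(2)[of v v] by (simp add: fZ B_simps nX)
    qed
  qed
  define E' where "E' = (\<lambda>(u, v). {f u, f v}) ` D"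
  have sD: "sym D" using sgraphD(6)[OF S] by (auto simp: D_def sym_def)
  have memE': "{f u, f v} \<in> E' \<longleftrightarrow> (u, v) \<in> D" if "u \<in> V" "v \<in> V" for u v
  proof
    assume "{f u, f v} \<in> E'"
    then obtain a b where ab: "(a, b) \<in> D" "{f u, f v} = {f a, f b}" by (auto simp: E'_def)
    have "a \<in> V" "b \<in> V" using ab(1) by (auto simp: D_def)
    then have "u = a \<and> v = b \<or> u = b \<and> v = a"
      using ab(2) that inj_onD[OF inj] unfolding doubleton_eq_iff by blast
    then show "(u, v) \<in> D" using ab(1) symD[OF sD] by blast
  next
    assume "(u, v) \<in> D"
    then show "{f u, f v} \<in> E'" unfolding E'_def by (rule rev_image_eqI) simp
  qed
  have pB: "pair_graph B"
    unfolding B_def by (intro pair_graph_join pair_graph_disjoint_union pair_graph_complete_graph P)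
  have "parcs (delete_edges B E') = map_prod f f ` E"
  proof (intro equalityI subsetI)
    fix a assume a: "a \<in> parcs (delete_edges B E')"
    then have aB: "(fst a, snd a) \<in> parcs B" by (simp add: delete_edges_def split_def)
    then have "fst a \<in> f ` V" "snd a \<in> f ` V"
      using pair_graph_arcD(1,2)[OF pB aB] bij by (simp_all add: bij_betw_def)
    then obtain u v where uv: "u \<in> V" "v \<in> V" "a = (f u, f v)" by (metis imageE prod.collapse)
    then have "(u, v) \<in> E" using a arcB[OF uv(1,2)] memE'[OF uv(1,2)]
      by (auto simp: delete_edges_def D_def)
    then show "a \<in> map_prod f f ` E" using uv(3) by auto
  next
    fix a assume "a \<in> map_prod f f ` E"
    then obtain u v where uv: "(u, v) \<in> E" "a = (f u, f v)" by auto
    then have "u \<in> V" "v \<in> V" "u \<noteq> v" "(u, v) \<notin> D"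
      using sgraphD(4,5,7)[OF S uv(1)] by (auto simp: D_def)
    then show "a \<in> parcs (delete_edges B E')"
      using uv arcB memE' by (simp add: delete_edges_def)
  qed
  moreover have "pverts (delete_edges B E') = pverts B" by (simp add: delete_edges_def)
  ultimately have "digraph_iso (with_proj G) (with_proj (delete_edges B E'))"
    unfolding digraph_iso_with_proj_iff[OF G] using bij by (auto simp: V_def E_def)
  moreover have "card E' \<le> b"
  proof -
    \<comment> \<open>Each deleted edge stands for two pairs in \<open>D\<close>, so fewer than
      \<open>2 * (b + 1)\<close> pairs means at most \<open>b\<close> edges.\<close>
    have "2 * card E' \<le> card D"
      unfolding E'_def
    proof (rule card_unordered_pairs[OF _ sD])
      show "finite D" using fV by (simp add: D_def)
      show "irrefl D" by (auto simp: D_def irrefl_def)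
      show "inj_on f (Field D)" using inj by (rule inj_on_subset) (auto simp: D_def Field_def)
    qed
    then show ?thesis using F by (simp add: D_def V_def E_def)
  qed
  moreover have "E' \<subseteq> {e \<in> edges B. e \<subseteq> Inl ` pverts (complete_graph y)
        \<union> (Inr \<circ> Inl) ` pverts (complete_graph z)}"
  proof
    fix e assume "e \<in> E'"
    then obtain u v where uv: "(u, v) \<in> D" "e = {f u, f v}" by (auto simp: E'_def)
    then have "u \<in> Y \<union> Z" "v \<in> Y \<union> Z" "u \<in> V" "v \<in> V" "u \<noteq> v" "u \<notin> X" "v \<notin> X"
      by (auto simp: D_def Z_def)
    then have "(f u, f v) \<in> parcs B" using arcB by simp
    moreover have "f w \<in> Inl ` {..<y} \<union> (Inr \<circ> Inl) ` {..<z}" if "w \<in> Y \<union> Z" for w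
      using that
    proof
      assume "w \<in> Y"
      then show ?thesis using gYeq(2)[of w w] by (simp add: fY)
    next
      assume "w \<in> Z"
      then show ?thesis using gZeq(2)[of w w] by (simp add: fZ)
    qed
    ultimately show "e \<in> {e \<in> edges B. e \<subseteq> Inl ` pverts (complete_graph y)
        \<union> (Inr \<circ> Inl) ` pverts (complete_graph z)}"
      using uv(2) \<open>u \<in> Y \<union> Z\<close> \<open>v \<in> Y \<union> Z\<close>
      unfolding edges_def complete_graph_def by (simp del: Un_iff) blast
  qed
  ultimately show ?thesis by blast
qed

theorem theorem1p2:
  fixes G :: "'a pair_pre_digraph" and n k :: nat
  assumes "k > 1"
    and "n \<ge> k ^ 4 + k ^ 3 + 4 * k ^ 2 + k + 6"
    and "pair_graph G"
    and "Digraph_Component.connected (with_proj G)"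
    and "card (pverts G) = n"
    and "min_degree G \<ge> k"
    and "q_index G \<ge> 2 * (real n - real k - 1)"
  shows "has_hamiltonian_cycle G
    \<or> mem_up_to_iso G (M1_family n k) \<or> mem_up_to_iso G (L1_family n k)"
proof (cases "hamiltonian (pverts G) (parcs G)")
  case True
  then show ?thesis using has_hamiltonian_cycle_if_hamiltonian[OF assms(3)] by blast
next
  case False
  note k = assms(1,2) and G = assms(3) and n = assms(5) and q = assms(7)
  note S = sgraph_pair_graph[OF G]
  have k2: "2 \<le> k" using k by simp
  have "pverts G \<noteq> {}" using n k by auto
  then obtain x where ev: "signless_eigenvector (pverts G) (parcs G) (q_index G) x"
    using signless_eigenvector_q_index[OF G] by blast
  have min: "k \<le> deg (parcs G) v" if "v \<in> pverts G" for v
  proof -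
    have "min_degree G \<le> deg (parcs G) v"
      unfolding min_degree_def out_degree_eq_deg using that finite_pverts[OF G] by (intro Min_le) auto
    then show ?thesis using assms(6) by simp
  qed
  have size: "(real n - 1) * (real n - 2 * real k) \<le> real (card (parcs G))"
    by (rule eigenvalue_size_bound[OF S n _ ev q]) (use min k in force)
  \<comment> \<open>From \<open>2 * k \<le> k^2\<close> and \<open>4 * k^2 \<le> k^4\<close>, the
    left side is at most \<open>7 * k^2\<close>, while \<open>n\<close> exceeds
    \<open>8 * k^2\<close>.\<close>
  have big: "2 * k ^ 2 + 10 * k < n"
  proof -
    have "2 * k \<le> k ^ 2" using k2 by (simp add: power2_eq_square)
    moreover have "k ^ 2 * 4 \<le> k ^ 2 * k ^ 2" using power_mono[OF k2, of 2] by (intro mult_left_mono) auto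
    then have "4 * k ^ 2 \<le> k ^ 4" by (simp flip: power_add)
    ultimately show ?thesis using k(2) by linarith
  qed
  have "0 < k" using k by simp
  then obtain X Y where X: "X \<subseteq> pverts G" "card X = k" and Y: "Y \<subseteq> pverts G - X"
    and cases: "card Y = k \<and> (\<forall>v\<in>X. parcs G `` {v} = Y)
      \<or> card Y = 1 \<and> (\<forall>v\<in>X. parcs G `` {v} = Y \<union> (X - {v}))"
    using nonhamiltonian_structure[OF S False n _ big min size connected_crossing_arc[OF G assms(4)]]
    by blast
  have fX: "finite X" using X(1) finite_pverts[OF G] finite_subset by blast
  obtain g where g: "bij_betw g X {..<k}" using finite_same_card_bij[OF fX, of "{..<k}"] X(2) by auto
  from cases show ?thesis
  proof (elim disjE conjE)
    assume cY: "card Y = k" and nb: "\<forall>v\<in>X. parcs G `` {v} = Y"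
    then have F: "card ((pverts G - X) \<times> (pverts G - X) - Id - parcs G) < 2 * (k\<^sup>2 div 4 + 1)"
      using M_few_missing[OF S n ev k2 k(2) X Y] q by blast
    have "\<exists>E'\<subseteq>M_E1 k n. card E' \<le> k\<^sup>2 div 4
        \<and> digraph_iso (with_proj G) (with_proj (delete_edges (M_graph k n) E'))"
      unfolding M_E1_def M_graph_def M_Y_def M_Z_def
    proof (rule iso_join_delete_edges[OF G X(1) Y cY _ _ pair_graph_edgeless_graph])
      show "card (pverts G) - card X - k = n - 2 * k" using n X(2) by simp
      show "bij_betw g X (pverts (edgeless_graph k))" using g by (simp add: edgeless_graph_def)
      show "parcs G `` {u} - X = Y" if "u \<in> X" for u using nb that Y by blast
      show "(g u, g v) \<in> parcs (edgeless_graph k) \<longleftrightarrow> (u, v) \<in> parcs G" if "u \<in> X" "v \<in> X" for u v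
        unfolding edgeless_graph_def using nb that Y by (simp, blast)
    qed (rule F)
    then obtain E' where E': "E' \<subseteq> M_E1 k n" "card E' \<le> k\<^sup>2 div 4"
      and iso: "digraph_iso (with_proj G) (with_proj (delete_edges (M_graph k n) E'))" by blast
    have "4 * card E' \<le> k\<^sup>2" using E'(2) by linarith
    then have "real (4 * card E') \<le> real (k\<^sup>2)" using of_nat_le_iff by blast
    then have "int (card E') \<le> \<lfloor>real k ^ 2 / 4\<rfloor>" by (simp add: le_floor_iff)
    then have "delete_edges (M_graph k n) E' \<in> M1_family n k"
      unfolding M1_family_def using E'(1) by blast
    then show ?thesis unfolding mem_up_to_iso_def using iso by blast
  next
    assume cY: "card Y = 1" and nb: "\<forall>v\<in>X. parcs G `` {v} = Y \<union> (X - {v})"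
    then have F: "card ((pverts G - X) \<times> (pverts G - X) - Id - parcs G) < 2 * (k div 4 + 1)"
      using L_few_missing[OF S n ev k2 k(2) X Y] q by blast
    have "\<exists>E'\<subseteq>L_E1 k n. card E' \<le> k div 4
        \<and> digraph_iso (with_proj G) (with_proj (delete_edges (L_graph k n) E'))"
      unfolding L_E1_def L_graph_def L_Y_def L_Z_def
    proof (rule iso_join_delete_edges[OF G X(1) Y cY _ _ pair_graph_complete_graph])
      show "card (pverts G) - card X - 1 = n - k - 1" using n X(2) by simp
      show "bij_betw g X (pverts (complete_graph k))" using g by (simp add: complete_graph_def)
      show "(g u, g v) \<in> parcs (complete_graph k) \<longleftrightarrow> (u, v) \<in> parcs G" if "u \<in> X" "v \<in> X" for u v
      proof -
        have "v \<in> parcs G `` {u} \<longleftrightarrow> v \<in> Y \<union> (X - {u})" using nb that(1) by blast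
        then have "(u, v) \<in> parcs G \<longleftrightarrow> u \<noteq> v" using that(2) Y by blast
        moreover have "g u < k" "g v < k" "g u = g v \<longleftrightarrow> u = v"
          using g that by (auto simp: bij_betw_def inj_on_def)
        ultimately show ?thesis by (simp add: complete_graph_def)
      qed
      show "parcs G `` {u} - X = Y" if "u \<in> X" for u using nb that Y by blast
    qed (rule F)
    then obtain E' where E': "E' \<subseteq> L_E1 k n" "card E' \<le> k div 4"
      and iso: "digraph_iso (with_proj G) (with_proj (delete_edges (L_graph k n) E'))" by blast
    have "4 * card E' \<le> k" using E'(2) by linarith
    then have "real (4 * card E') \<le> real k" using of_nat_le_iff by blast
    then have "int (card E') \<le> \<lfloor>real k / 4\<rfloor>" by (simp add: le_floor_iff)
    then have "delete_edges (L_graph k n) E' \<in> L1_family n k"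
      unfolding L1_family_def using E'(1) by blast
    then show ?thesis unfolding mem_up_to_iso_def using iso by blast
  qed
qed

end
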